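(* Let $d\ge2$, $\alpha\in(0,1)$, let $m\ge1$ be an integer, let $\Omega$ be a bounded $\mathscr{C}^{1,\alpha}$ domain in $\mathbb{R}^d$ with $\mathbb{R}^d\setminus\overline\Omega$ connected, and let $\Psi:\overline\Omega\to\overline\Omega$ be a $\mathscr{C}^{m+2}$ (resp. $\mathscr{C}^\infty$, or real-analytic) diffeomorphism on $\overline\Omega$ satisfying $\Psi|_{\partial\Omega}=\mathrm{Id}$. Let $\nu$ be the unit outward normal to $\partial\Omega$ and define $$A=\frac{D\Psi\,D^T\Psi}{|\det D\Psi|}\circ\Psi^{-1}\quad\text{in }\overline\Omega.$$ Then $A\,\nu=\nu$ at every point $x_0\in\partial\Omega$ such that $\partial\Omega$ is not $\mathscr{C}^{m,\alpha}$ (resp. $\mathscr{C}^\infty$, or real-analytic) in any neighbourhood of $x_0$.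
   Context: $D\Psi$ is the Jacobian matrix of $\Psi$ and $D^T\Psi$ its transpose. The three regularity classes are to be read respectively: $\Psi\in\mathscr{C}^{m+2}$ with $\partial\Omega$ not $\mathscr{C}^{m,\alpha}$ near $x_0$; $\Psi\in\mathscr{C}^\infty$ with $\partial\Omega$ not $\mathscr{C}^\infty$ near $x_0$; $\Psi$ real-analytic with $\partial\Omega$ not real-analytic near $x_0$. *)

theory Defs
  imports "HOL-Analysis.Analysis"
begin

definition partial :: "'n::finite \<Rightarrow> (real^'n \<Rightarrow> real) \<Rightarrow> real^'n \<Rightarrow> real" where
  "partial i f x = frechet_derivative f (at x) (axis i 1)"

primrec iter_partial :: "'n::finite list \<Rightarrow> (real^'n \<Rightarrow> real) \<Rightarrow> real^'n \<Rightarrow> real" where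
  "iter_partial [] f = f"
| "iter_partial (i # is) f = partial i (iter_partial is f)"

definition C_k :: "nat \<Rightarrow> (real^'n::finite \<Rightarrow> real) \<Rightarrow> (real^'n) set \<Rightarrow> bool" where
  "C_k k f U \<longleftrightarrow>
     (\<forall>is. length is < k \<longrightarrow> (\<forall>x\<in>U. iter_partial is f differentiable (at x))) \<and>
     (\<forall>is. length is \<le> k \<longrightarrow> continuous_on U (iter_partial is f))"

definition C_infty :: "(real^'n::finite \<Rightarrow> real) \<Rightarrow> (real^'n) set \<Rightarrow> bool" where
  "C_infty f U \<longleftrightarrow> (\<forall>k. C_k k f U)"

definition holder_on :: "real \<Rightarrow> (real^'n::finite \<Rightarrow> real) \<Rightarrow> (real^'n) set \<Rightarrow> bool" where
  "holder_on \<alpha> f U \<longleftrightarrow> (\<exists>K. \<forall>x\<in>U. \<forall>y\<in>U. \<bar>f x - f y\<bar> \<le> K * dist x y powr \<alpha>)"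

definition C_k_holder :: "nat \<Rightarrow> real \<Rightarrow> (real^'n::finite \<Rightarrow> real) \<Rightarrow> (real^'n) set \<Rightarrow> bool" where
  "C_k_holder k \<alpha> f U \<longleftrightarrow>
     C_k k f U \<and> (\<forall>is. length is = k \<longrightarrow> holder_on \<alpha> (iter_partial is f) U)"

(* Local expansion into a multivariate power series; b ranges over the multi-indices. *)
definition real_analytic :: "(real^'n::finite \<Rightarrow> real) \<Rightarrow> (real^'n) set \<Rightarrow> bool" where
  "real_analytic f U \<longleftrightarrow>
     (\<forall>x\<in>U. \<exists>r>0. \<exists>c :: ('n \<Rightarrow> nat) \<Rightarrow> real. \<forall>y\<in>ball x r.
        ((\<lambda>b. c b * (\<Prod>i\<in>UNIV. (y $ i - x $ i) ^ b i)) has_sum f y) UNIV)"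

(* The classes up to the boundary of an open set W. For C_k and C_infty all derivatives
   taken in W must extend continuously to the closure; a real-analytic function on the
   closure is one that extends to a real-analytic function on an open neighbourhood. *)

definition C_k_closure :: "nat \<Rightarrow> (real^'n::finite \<Rightarrow> real) \<Rightarrow> (real^'n) set \<Rightarrow> bool" where
  "C_k_closure k f W \<longleftrightarrow>
     C_k k f W \<and> continuous_on (closure W) f \<and>
     (\<forall>is. length is \<le> k \<longrightarrow>
        (\<exists>g. continuous_on (closure W) g \<and> (\<forall>x\<in>W. g x = iter_partial is f x)))"

definition C_infty_closure :: "(real^'n::finite \<Rightarrow> real) \<Rightarrow> (real^'n) set \<Rightarrow> bool" where
  "C_infty_closure f W \<longleftrightarrow> (\<forall>k. C_k_closure k f W)"

definition real_analytic_closure :: "(real^'n::finite \<Rightarrow> real) \<Rightarrow> (real^'n) set \<Rightarrow> bool" where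
  "real_analytic_closure f W \<longleftrightarrow>
     (\<exists>V F. open V \<and> closure W \<subseteq> V \<and> real_analytic F V \<and> (\<forall>x\<in>closure W. F x = f x))"

definition diffeo_on_closure ::
    "((real^'n::finite \<Rightarrow> real) \<Rightarrow> (real^'n) set \<Rightarrow> bool) \<Rightarrow>
     (real^'n \<Rightarrow> real^'n) \<Rightarrow> (real^'n) set \<Rightarrow> bool" where
  "diffeo_on_closure R \<Psi> W \<longleftrightarrow>
     bij_betw \<Psi> (closure W) (closure W) \<and>
     (\<forall>i. R (\<lambda>x. \<Psi> x $ i) W) \<and>
     (\<forall>i. R (\<lambda>x. inv_into (closure W) \<Psi> x $ i) W)"

(* Near x, W is the part lying below the graph, in the direction e, of a function g of
   class R over the hyperplane through x orthogonal to e; the argument of g below is the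
   orthogonal projection of y to that hyperplane. Only the values of g there matter: a
   function on a disc of the hyperplane is extended to the ball constantly along e, which
   preserves each of the classes above. *)
definition boundary_regular_at ::
    "((real^'n::finite \<Rightarrow> real) \<Rightarrow> (real^'n) set \<Rightarrow> bool) \<Rightarrow> (real^'n) set \<Rightarrow> real^'n \<Rightarrow> bool" where
  "boundary_regular_at R W x \<longleftrightarrow>
     (\<exists>r>0. \<exists>e g. norm e = 1 \<and> R g (ball x r) \<and>
        (\<forall>y\<in>ball x r. y \<in> W \<longleftrightarrow> (y - x) \<bullet> e < g (y - ((y - x) \<bullet> e) *\<^sub>R e)))"

definition boundary_regular_in ::
    "((real^'n::finite \<Rightarrow> real) \<Rightarrow> (real^'n) set \<Rightarrow> bool) \<Rightarrow> (real^'n) set \<Rightarrow> (real^'n) set \<Rightarrow> bool" where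
  "boundary_regular_in R W N \<longleftrightarrow> (\<forall>x\<in>frontier W \<inter> N. boundary_regular_at R W x)"

definition boundary_irregular_near ::
    "((real^'n::finite \<Rightarrow> real) \<Rightarrow> (real^'n) set \<Rightarrow> bool) \<Rightarrow> (real^'n) set \<Rightarrow> real^'n \<Rightarrow> bool" where
  "boundary_irregular_near R W x \<longleftrightarrow>
     (\<forall>N. open N \<and> x \<in> N \<longrightarrow> \<not> boundary_regular_in R W N)"

definition regular_domain ::
    "((real^'n::finite \<Rightarrow> real) \<Rightarrow> (real^'n) set \<Rightarrow> bool) \<Rightarrow> (real^'n) set \<Rightarrow> bool" where
  "regular_domain R W \<longleftrightarrow>
     open W \<and> connected W \<and> W \<noteq> {} \<and> boundary_regular_in R W UNIV"

(* Velocities at x of curves lying in S and differentiable at x. *)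
definition tangent_vectors :: "(real^'n::finite) set \<Rightarrow> real^'n \<Rightarrow> (real^'n) set" where
  "tangent_vectors S x =
     {v. \<exists>\<gamma>. \<exists>\<epsilon>>0. \<gamma> 0 = x \<and> (\<forall>t\<in>{-\<epsilon><..<\<epsilon>}. \<gamma> t \<in> S) \<and> (\<gamma> has_vector_derivative v) (at 0)}"

definition is_unit_outward_normal :: "(real^'n::finite) set \<Rightarrow> real^'n \<Rightarrow> real^'n \<Rightarrow> bool" where
  "is_unit_outward_normal W x n \<longleftrightarrow>
     norm n = 1 \<and>
     (\<forall>v\<in>tangent_vectors (frontier W) x. n \<bullet> v = 0) \<and>
     (\<exists>\<epsilon>>0. \<forall>t\<in>{0<..<\<epsilon>}. x + t *\<^sub>R n \<notin> closure W \<and> x - t *\<^sub>R n \<in> W)"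

(* On the frontier of W the derivative is the one relative to the closure, unique when
   the boundary is of class C_k with k at least 1. *)
definition jacobian_closure ::
    "(real^'n::finite) set \<Rightarrow> (real^'n \<Rightarrow> real^'n) \<Rightarrow> real^'n \<Rightarrow> real^'n^'n" where
  "jacobian_closure W \<Psi> x = matrix (frechet_derivative \<Psi> (at x within closure W))"

definition push_forward_coeff ::
    "(real^'n::finite) set \<Rightarrow> (real^'n \<Rightarrow> real^'n) \<Rightarrow> real^'n \<Rightarrow> real^'n^'n" where
  "push_forward_coeff W \<Psi> x =
     (let J = jacobian_closure W \<Psi> (inv_into (closure W) \<Psi> x)
      in (1 / \<bar>det J\<bar>) *\<^sub>R (J ** transpose J))"

end

(* Write f = Psi_i - x_i; it vanishes on the boundary. If the derivative of Psi at x0 (relative to the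
   closure) is the identity, then A = I there. Otherwise some f has a nonzero gradient at x0, and the
   boundary, locally the graph of a C^1 function gamma, is the zero set of f near x0.

   In the C^k classes no extension of Psi across the boundary is needed: differentiating f = 0 along
   the graph gives grad gamma = e - F / (F . e), where F is the boundary trace of grad f. Traces of C^j
   functions along a C^j graph are C^j, so gamma gains one derivative at a time until it reaches the
   regularity of f.

   In the analytic class the equation f = 0 is solved by the Newton-like iteration
   u -> u - f(graph of u) / (grad f(x0) . e), which is a contraction both in the weighted l^1 norm of
   the Taylor coefficients and pointwise; pointwise the iterates tend to gamma. *)

theory Submission
  imports Defs
begin

text \<open>The argument is contrapositive: where \<open>A\<close> differs from the identity, the
  boundary is shown to be regular. In the C^k classes the obstacle is that \<Psi> has only one-sided
  derivatives at boundary points. Below a Lipschitz graph every point of the closure carries a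
  downward cone inside the domain. The cone makes the continuous extension of the gradient a
  derivative relative to the closure, and makes such a derivative unique. This is enough for a chain
  rule along the graph, which lies in the closure. Transversality comes for free: f = 0 on the graph
  gives F + (F . e)(grad gamma - e) = 0, so F . e = 0 would force F = 0. In the analytic class gamma
  is not known beforehand to have a power series, hence the two contractions. The one in the
  weighted norm compares iterates with each other and makes their increments summable as series; the
  pointwise one compares them with gamma and identifies the sum. Functions on the hyperplane are
  represented by functions of all d variables that are constant along e, so no coordinates on it are
  chosen.\<close>

section \<open>Functions with derivatives extending continuously\<close>

text \<open>The derivatives up to order \<open>k\<close> are taken on the open set \<open>S\<close> and agree there with
  continuous functions on the larger set \<open>T\<close>.\<close>

primrec Ck_ext :: "nat \<Rightarrow> (real^'n::finite \<Rightarrow> real) \<Rightarrow> (real^'n) set \<Rightarrow> (real^'n) set \<Rightarrow> bool" where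
  "Ck_ext 0 f S T \<longleftrightarrow> continuous_on T f"
| "Ck_ext (Suc k) f S T \<longleftrightarrow> continuous_on T f \<and>
     (\<exists>F. (\<forall>x\<in>S. (f has_derivative (\<lambda>v. F x \<bullet> v)) (at x)) \<and> (\<forall>i. Ck_ext k (\<lambda>x. F x $ i) S T))"

lemma Ck_ext_imp_continuous_on: "Ck_ext k f S T \<Longrightarrow> continuous_on T f"
  by (cases k) auto

lemma Ck_ext_SucI:
  assumes "continuous_on T f" "\<And>x. x \<in> S \<Longrightarrow> (f has_derivative (\<lambda>v. F x \<bullet> v)) (at x)"
    "\<And>i. Ck_ext k (\<lambda>x. F x $ i) S T"
  shows "Ck_ext (Suc k) f S T"
  using assms by auto

lemma Ck_ext_SucE:
  assumes "Ck_ext (Suc k) f S T"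
  obtains F where "continuous_on T f" "\<And>x. x \<in> S \<Longrightarrow> (f has_derivative (\<lambda>v. F x \<bullet> v)) (at x)"
    "\<And>i. Ck_ext k (\<lambda>x. F x $ i) S T"
  using assms by auto

lemma Ck_ext_cong:
  assumes "open S" "S \<subseteq> T" "\<And>x. x \<in> T \<Longrightarrow> f x = g x" "Ck_ext k f S T"
  shows "Ck_ext k g S T"
proof -
  have c: "continuous_on T g" 
    using Ck_ext_imp_continuous_on[OF assms(4)] assms(3) by (simp cong: continuous_on_cong)
  show ?thesis
  proof (cases k)
    case 0
    then show ?thesis using c by simp
  next
    case (Suc j)
    then obtain F where F: "\<And>x. x \<in> S \<Longrightarrow> (f has_derivative (\<lambda>v. F x \<bullet> v)) (at x)"
      "\<And>i. Ck_ext j (\<lambda>x. F x $ i) S T"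
      using assms(4) by (auto elim!: Ck_ext_SucE)
    have "(g has_derivative (\<lambda>v. F x \<bullet> v)) (at x)" if "x \<in> S" for x
      by (rule has_derivative_transform_within_open[OF F(1)[OF that] assms(1) that])
        (use assms in auto)
    then show ?thesis unfolding Suc using c F(2) by (intro Ck_ext_SucI) auto
  qed
qed

lemma Ck_ext_Suc_imp: "Ck_ext (Suc k) f S T \<Longrightarrow> Ck_ext k f S T"
proof (induction k arbitrary: f)
  case (Suc k)
  then obtain F where "continuous_on T f" "\<And>x. x \<in> S \<Longrightarrow> (f has_derivative (\<lambda>v. F x \<bullet> v)) (at x)"
    "\<And>i. Ck_ext (Suc k) (\<lambda>x. F x $ i) S T"
    by (auto elim!: Ck_ext_SucE[of "Suc k"] simp del: Ck_ext.simps)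
  then show ?case using Suc.IH by (intro Ck_ext_SucI) auto
qed simp

lemma Ck_ext_mono: "j \<le> k \<Longrightarrow> Ck_ext k f S T \<Longrightarrow> Ck_ext j f S T"
  by (induction k rule: dec_induct) (auto dest: Ck_ext_Suc_imp simp del: Ck_ext.simps)

lemma Ck_ext_const: "Ck_ext k (\<lambda>_. c) S T"
proof (induction k arbitrary: c)
  case (Suc k)
  show ?case by (rule Ck_ext_SucI[where F = "\<lambda>_. 0"]) (auto simp: Suc)
qed simp

lemma Ck_ext_coord: "Ck_ext k (\<lambda>x. x $ i) S T"
proof (cases k)
  case (Suc j)
  have "((\<lambda>x. x $ i) has_derivative (\<lambda>v. axis i 1 \<bullet> v)) (at x)" for x :: "real^'a"
    using bounded_linear.has_derivative[OF bounded_linear_vec_nth has_derivative_ident] by (simp add: inner_axis')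
  then show ?thesis unfolding Suc
    by (intro Ck_ext_SucI[where F = "\<lambda>_. axis i 1"]) (auto intro!: Ck_ext_const continuous_intros)
qed (auto intro!: continuous_intros)

lemma Ck_ext_add:
  "Ck_ext k f S T \<Longrightarrow> Ck_ext k g S T \<Longrightarrow> Ck_ext k (\<lambda>x. f x + g x) S T"
proof (induction k arbitrary: f g)
  case (Suc k)
  from Suc.prems(1) obtain F where F: "continuous_on T f" "\<And>x. x \<in> S \<Longrightarrow> (f has_derivative (\<lambda>v. F x \<bullet> v)) (at x)"
    "\<And>i. Ck_ext k (\<lambda>x. F x $ i) S T" by (auto elim!: Ck_ext_SucE simp del: Ck_ext.simps)
  from Suc.prems(2) obtain G where G: "continuous_on T g" "\<And>x. x \<in> S \<Longrightarrow> (g has_derivative (\<lambda>v. G x \<bullet> v)) (at x)"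
    "\<And>i. Ck_ext k (\<lambda>x. G x $ i) S T" by (auto elim!: Ck_ext_SucE simp del: Ck_ext.simps)
  show ?case
    by (rule Ck_ext_SucI[where F = "\<lambda>x. F x + G x"])
      (use F G Suc.IH in \<open>auto intro!: continuous_intros derivative_eq_intros simp: inner_add_left\<close>)
qed (auto intro!: continuous_intros)

lemma Ck_ext_mult:
  "Ck_ext k f S T \<Longrightarrow> Ck_ext k g S T \<Longrightarrow> Ck_ext k (\<lambda>x. f x * g x) S T"
proof (induction k arbitrary: f g)
  case (Suc k)
  note fg = Suc.prems[THEN Ck_ext_Suc_imp]
  from Suc.prems(1) obtain F where F: "continuous_on T f" "\<And>x. x \<in> S \<Longrightarrow> (f has_derivative (\<lambda>v. F x \<bullet> v)) (at x)"
    "\<And>i. Ck_ext k (\<lambda>x. F x $ i) S T" by (auto elim!: Ck_ext_SucE simp del: Ck_ext.simps)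
  from Suc.prems(2) obtain G where G: "continuous_on T g" "\<And>x. x \<in> S \<Longrightarrow> (g has_derivative (\<lambda>v. G x \<bullet> v)) (at x)"
    "\<And>i. Ck_ext k (\<lambda>x. G x $ i) S T" by (auto elim!: Ck_ext_SucE simp del: Ck_ext.simps)
  show ?case
    by (rule Ck_ext_SucI[where F = "\<lambda>x. f x *\<^sub>R G x + g x *\<^sub>R F x"])
      (use F G fg in \<open>auto intro!: continuous_intros derivative_eq_intros Ck_ext_add Suc.IH
         simp: inner_add_left algebra_simps\<close>)
qed (auto intro!: continuous_intros)

lemma Ck_ext_diff:
  assumes "Ck_ext k f S T" "Ck_ext k g S T"
  shows "Ck_ext k (\<lambda>x. f x - g x) S T"
  using Ck_ext_add[OF assms(1) Ck_ext_mult[OF Ck_ext_const[of k "-1"] assms(2)]] by simp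

lemma Ck_ext_sum:
  "(\<And>i. i \<in> I \<Longrightarrow> Ck_ext k (f i) S T) \<Longrightarrow> Ck_ext k (\<lambda>x. \<Sum>i\<in>I. f i x) S T"
  by (induction I rule: infinite_finite_induct) (auto intro!: Ck_ext_const Ck_ext_add)

lemma Ck_ext_inverse:
  assumes "S \<subseteq> T" "\<And>x. x \<in> T \<Longrightarrow> f x \<noteq> 0"
  shows "Ck_ext k f S T \<Longrightarrow> Ck_ext k (\<lambda>x. inverse (f x)) S T"
proof (induction k)
  case (Suc k)
  note IH = Suc.IH[OF Ck_ext_Suc_imp[OF Suc.prems]]
  from Suc.prems(1) obtain F where F: "continuous_on T f" "\<And>x. x \<in> S \<Longrightarrow> (f has_derivative (\<lambda>v. F x \<bullet> v)) (at x)"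
    "\<And>i. Ck_ext k (\<lambda>x. F x $ i) S T" by (auto elim!: Ck_ext_SucE simp del: Ck_ext.simps)
  show ?case
  \<comment> \<open>The gradient - F / f^2 is written as a product, so that its components are
    covered by the induction hypothesis for \<open>inverse\<close> and closure under
    products.\<close>
  proof (rule Ck_ext_SucI[where F = "\<lambda>x. (- 1 * inverse (f x) * inverse (f x)) *\<^sub>R F x"])
    show "continuous_on T (\<lambda>x. inverse (f x))"
      using F(1) assms(2) by (intro continuous_intros) auto
    show "((\<lambda>x. inverse (f x)) has_derivative (\<lambda>v. (- 1 * inverse (f x) * inverse (f x)) *\<^sub>R F x \<bullet> v)) (at x)"
      if "x \<in> S" for x
      using Deriv.has_derivative_inverse[OF _ F(2)[OF that]] assms that by (auto simp: mult_ac)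
    show "Ck_ext k (\<lambda>x. ((- 1 * inverse (f x) * inverse (f x)) *\<^sub>R F x) $ i) S T" for i
      unfolding vector_scaleR_component real_scaleR_def
      by (intro Ck_ext_mult Ck_ext_const IH F(3))
  qed
qed (use assms in \<open>auto intro!: continuous_intros\<close>)

section \<open>Comparison with iterated partial derivatives\<close>

lemma partial_eq:
  assumes "(f has_derivative (\<lambda>v. F \<bullet> v)) (at x)"
  shows "partial i f x = F $ i"
proof -
  have "partial i f x = F \<bullet> axis i 1"
    unfolding partial_def using frechet_derivative_at[OF assms, symmetric] by simp
  then show ?thesis by (simp add: inner_axis)
qed

lemma differentiable_has_gradient:
  assumes "f differentiable (at x)"
  shows "(f has_derivative (\<lambda>v. (\<chi> i. partial i f x) \<bullet> v)) (at x)"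
proof -
  let ?D = "frechet_derivative f (at x)"
  have D: "(f has_derivative ?D) (at x)" using assms by (simp add: frechet_derivative_works)
  then interpret D: linear ?D by (rule has_derivative_linear)
  have "?D v = (\<chi> i. partial i f x) \<bullet> v" for v
  proof -
    have "?D v = ?D (\<Sum>i\<in>UNIV. (v $ i) *\<^sub>R axis i 1)"
      by (simp add: basis_expansion flip: scalar_mult_eq_scaleR)
    also have "\<dots> = (\<chi> i. partial i f x) \<bullet> v"
      by (simp add: D.sum D.scale inner_vec_def partial_def mult.commute)
    finally show ?thesis .
  qed
  then show ?thesis using D by presburger
qed

lemma Ck_ext_iter_partial:
  assumes "open U" "Ck_ext k f U U"
  shows "length is \<le> k \<Longrightarrow> Ck_ext (k - length is) (iter_partial is f) U U"
proof (induction "is")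
  case (Cons i js)
  then have "Ck_ext (Suc (k - length (i # js))) (iter_partial js f) U U"
    by (metis Suc_diff_le Suc_leD diff_Suc_Suc length_Cons)
  then obtain F where F: "\<And>x. x \<in> U \<Longrightarrow> (iter_partial js f has_derivative (\<lambda>v. F x \<bullet> v)) (at x)"
    "\<And>i. Ck_ext (k - length (i # js)) (\<lambda>x. F x $ i) U U"
    by (auto elim!: Ck_ext_SucE simp del: Ck_ext.simps)
  show ?case
    by (rule Ck_ext_cong[OF assms(1) _ _ F(2)[of i]]) (use partial_eq[OF F(1)] in auto)
qed (use assms in auto)

lemma Ck_ext_imp_C_k:
  assumes "open U" "Ck_ext k f U U"
  shows "C_k k f U"
  unfolding C_k_def
proof (intro conjI allI impI ballI)
  fix "is" :: "'a list" and x assume "length is < k" "x \<in> U"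
  then obtain j where "k - length is = Suc j" by (metis Suc_diff_Suc)
  then have "Ck_ext (Suc j) (iter_partial is f) U U"
    using Ck_ext_iter_partial[OF assms, of "is"] \<open>length is < k\<close> by simp
  then show "iter_partial is f differentiable (at x)"
    using \<open>x \<in> U\<close> by (auto simp: differentiable_def)
next
  fix "is" :: "'a list" assume "length is \<le> k"
  then show "continuous_on U (iter_partial is f)"
    using Ck_ext_iter_partial[OF assms] Ck_ext_imp_continuous_on by blast
qed

lemma C_k_closure_imp_Ck_ext:
  assumes "open W" "C_k_closure k f W"
  shows "Ck_ext k f W (closure W)"
proof -
  have "\<exists>g. continuous_on (closure W) g \<and> (\<forall>x\<in>W. g x = iter_partial is f x)" if "length is \<le> k" for "is"
    using assms that by (auto simp: C_k_closure_def)
  then obtain g where g: "\<And>is. length is \<le> k \<Longrightarrow> continuous_on (closure W) (g is)"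
    "\<And>is x. length is \<le> k \<Longrightarrow> x \<in> W \<Longrightarrow> g is x = iter_partial is f x" by metis
  \<comment> \<open>Stated for any \<open>h\<close> that agrees with
    \<open>iter_partial is f\<close> on \<open>W\<close>: on the frontier only the chosen continuous
    extension is available, and the gradient at level \<open>is\<close> is assembled from the
    extensions at \<open>i # is\<close>.\<close>
  have *: "Ck_ext j h W (closure W)"
    if "length is + j \<le> k" "continuous_on (closure W) h" "\<And>x. x \<in> W \<Longrightarrow> h x = iter_partial is f x" for "is" j h
    using that
  proof (induction j arbitrary: "is" h)
    case (Suc j)
    show ?case
    proof (rule Ck_ext_SucI[where F = "\<lambda>x. \<chi> i. g (i # is) x"])
      fix x assume x: "x \<in> W"
      have "iter_partial is f differentiable (at x)"
        using assms(2) Suc.prems(1) x by (auto simp: C_k_closure_def C_k_def)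
      then have "(iter_partial is f has_derivative (\<lambda>v. (\<chi> i. partial i (iter_partial is f) x) \<bullet> v)) (at x)"
        by (rule differentiable_has_gradient)
      then have "(h has_derivative (\<lambda>v. (\<chi> i. partial i (iter_partial is f) x) \<bullet> v)) (at x)"
        by (rule has_derivative_transform_within_open[OF _ assms(1) x]) (use Suc.prems in auto)
      moreover have "(\<chi> i. partial i (iter_partial is f) x) = (\<chi> i. g (i # is) x)"
        using Suc.prems(1) x g(2)[of "_ # is"] by (auto simp: vec_eq_iff)
      ultimately show "(h has_derivative (\<lambda>v. (\<chi> i. g (i # is) x) \<bullet> v)) (at x)" by simp
    next
      fix i
      have "Ck_ext j (g (i # is)) W (closure W)"
        by (rule Suc.IH[of "i # is"]) (use Suc.prems(1) g[of "i # is"] in auto)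
      then show "Ck_ext j (\<lambda>x. (\<chi> i. g (i # is) x) $ i) W (closure W)" by simp
    qed (use Suc.prems in auto)
  qed simp
  show ?thesis
    by (rule *[of "[]"]) (use assms in \<open>auto simp: C_k_closure_def\<close>)
qed

lemma C_k_1_imp_Ck_ext:
  assumes "C_k 1 f U"
  shows "Ck_ext 1 f U U"
proof -
  have "continuous_on U (iter_partial [] f)" "continuous_on U (iter_partial [i] f)" for i
    using assms unfolding C_k_def by (metis list.size(3) zero_le, metis One_nat_def length_Cons list.size(3) order_refl)
  moreover have "(f has_derivative (\<lambda>v. (\<chi> i. partial i f x) \<bullet> v)) (at x)" if "x \<in> U" for x
    using assms that by (intro differentiable_has_gradient) (force simp: C_k_def)
  ultimately show ?thesis
    by (auto intro!: exI[of _ "\<lambda>x. \<chi> i. partial i f x"])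
qed

lemma Ck_ext_subset: "Ck_ext k f S T \<Longrightarrow> S' \<subseteq> S \<Longrightarrow> T' \<subseteq> T \<Longrightarrow> Ck_ext k f S' T'"
proof (induction k arbitrary: f)
  case (Suc k)
  then obtain F where "continuous_on T f" "\<And>x. x \<in> S \<Longrightarrow> (f has_derivative (\<lambda>v. F x \<bullet> v)) (at x)"
    "\<And>i. Ck_ext k (\<lambda>x. F x $ i) S T"
    by (auto elim!: Ck_ext_SucE simp del: Ck_ext.simps)
  then show ?case using Suc.IH Suc.prems(2,3)
    by (intro Ck_ext_SucI[where F = F]) (auto intro: continuous_on_subset)
qed (auto intro: continuous_on_subset)

section \<open>Uniqueness of derivatives and Lipschitz bounds\<close>

lemma gradient_unique:
  fixes F G :: "real^'n::finite"
  assumes "(f has_derivative (\<lambda>v. F \<bullet> v)) (at x)" "(f has_derivative (\<lambda>v. G \<bullet> v)) (at x)"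
  shows "F = G"
  using partial_eq[OF assms(1)] partial_eq[OF assms(2)] by (simp add: vec_eq_iff)

lemma continuous_on_vec_components:
  assumes "\<And>i. continuous_on T (\<lambda>x. F x $ i)"
  shows "continuous_on T F"
  using continuous_on_vec_lambda[of T "\<lambda>i x. F x $ i"] assms by simp

text \<open>Within a general set a derivative need not be unique. Restriction to a segment starting
  at \<open>z\<close> reduces the question to one-sided derivatives on an interval, so the value is
  determined in every direction that points into the set.\<close>

lemma has_derivative_along_ray_unique:
  fixes h :: "'a::real_normed_vector \<Rightarrow> 'b::real_normed_vector"
  assumes A: "(h has_derivative A) (at z within S)" and B: "(h has_derivative B) (at z within S)"
    and d: "0 < d" "\<And>s. 0 \<le> s \<Longrightarrow> s \<le> d \<Longrightarrow> z + s *\<^sub>R w \<in> S"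
  shows "A w = B w"
proof -
  have *: "((\<lambda>s. h (z + s *\<^sub>R w)) has_vector_derivative D w) (at 0 within cbox 0 d)"
    if D: "(h has_derivative D) (at z within S)" for D
  proof -
    have "((\<lambda>s. z + s *\<^sub>R w) has_derivative (\<lambda>s. s *\<^sub>R w)) (at 0 within {0..d})"
      by (auto intro!: derivative_eq_intros)
    moreover have "(\<lambda>s. z + s *\<^sub>R w) ` {0..d} \<subseteq> S" using d(2) by auto
    from has_derivative_subset[OF D this]
    have "(h has_derivative D) (at (z + 0 *\<^sub>R w) within (\<lambda>s. z + s *\<^sub>R w) ` {0..d})" by simp
    ultimately have "((\<lambda>s. h (z + s *\<^sub>R w)) has_derivative (\<lambda>s. D (s *\<^sub>R w))) (at 0 within {0..d})"
      using has_derivative_in_compose by blast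
    then show ?thesis
      using has_derivative_linear[OF D] by (simp add: has_vector_derivative_def linear_cmul)
  qed
  show ?thesis
    using vector_derivative_unique_within_closed_interval[OF d(1) _ *[OF A] *[OF B]] d(1) by simp
qed

lemma gradient_bound_imp_lipschitz:
  fixes f :: "'a::euclidean_space \<Rightarrow> real"
  assumes "\<And>y. y \<in> cball x r \<Longrightarrow> (f has_derivative (\<lambda>v. F y \<bullet> v)) (at y)"
    and "continuous_on (cball x r) F"
  obtains L where "L \<ge> 0" "\<And>y z. y \<in> cball x r \<Longrightarrow> z \<in> cball x r \<Longrightarrow> \<bar>f y - f z\<bar> \<le> L * dist y z"
proof -
  have "bounded (F ` cball x r)"
    using assms(2) compact_continuous_image compact_cball compact_imp_bounded by blast
  then obtain L where L: "L > 0" "\<And>y. y \<in> cball x r \<Longrightarrow> norm (F y) \<le> L"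
    unfolding bounded_pos by auto
  have "norm (f y - f z) \<le> L * norm (y - z)" if "y \<in> cball x r" "z \<in> cball x r" for y z
  proof (rule differentiable_bound[of "cball x r" f "\<lambda>y v. F y \<bullet> v" L])
    show "onorm (\<lambda>v. F y \<bullet> v) \<le> L" if "y \<in> cball x r" for y
    proof (rule onorm_le)
      fix v show "norm (F y \<bullet> v) \<le> L * norm v"
        using Cauchy_Schwarz_ineq2[of "F y" v] mult_right_mono[OF L(2)[OF that] norm_ge_zero[of v]] by simp
    qed
    show "(f has_derivative (\<lambda>v. F y \<bullet> v)) (at y within cball x r)" if "y \<in> cball x r" for y
      using assms(1)[OF that] by (rule has_derivative_at_withinI)
  qed (use that in auto)
  then show ?thesis using that[of L] L(1) by (simp add: dist_norm)
qed

text \<open>One spare derivative makes the derivatives of order \<open>k\<close> Lipschitz on a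
  compact ball, and at distances at most 1 a Lipschitz bound implies a Hoelder bound.\<close>

lemma Ck_ext_imp_C_k_holder:
  assumes f: "Ck_ext (Suc k) f U U" and U: "open U" "y \<in> U" and \<alpha>: "\<alpha> \<le> 1"
  obtains r where "r > 0" "ball y r \<subseteq> U" "C_k_holder k \<alpha> f (ball y r)"
proof -
  obtain r0 where r0: "r0 > 0" "cball y r0 \<subseteq> U" using U open_contains_cball by blast
  \<comment> \<open>Radius at most 1/2 keeps two points of the ball at distance at most 1, where
    \<open>dist x z \<le> dist x z powr \<alpha>\<close>.\<close>
  define r where "r = min r0 (1/2)"
  have r: "r > 0" "r \<le> 1/2" "cball y r \<subseteq> U" using r0 by (auto simp: r_def)
  have sub: "ball y r \<subseteq> U" using r(3) ball_subset_cball by blast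
  have "holder_on \<alpha> (iter_partial is f) (ball y r)" if len: "length is = k" for "is"
  proof -
    have "Ck_ext (Suc 0) (iter_partial is f) U U"
      using Ck_ext_iter_partial[OF U(1) f, of "is"] len by simp
    then obtain F where F: "\<And>x. x \<in> U \<Longrightarrow> (iter_partial is f has_derivative (\<lambda>v. F x \<bullet> v)) (at x)"
      "\<And>i. Ck_ext 0 (\<lambda>x. F x $ i) U U" by (rule Ck_ext_SucE) blast
    have "continuous_on U F"
      using F(2) Ck_ext_imp_continuous_on continuous_on_vec_components by blast
    then obtain L where L: "L \<ge> 0" "\<And>x z. x \<in> cball y r \<Longrightarrow> z \<in> cball y r \<Longrightarrow>
        \<bar>iter_partial is f x - iter_partial is f z\<bar> \<le> L * dist x z"
      using gradient_bound_imp_lipschitz[of y r "iter_partial is f" F] F(1) r(3) continuous_on_subset by blast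
    show ?thesis unfolding holder_on_def
    proof (intro exI ballI)
      fix x z assume xz: "x \<in> ball y r" "z \<in> ball y r"
      have "dist x z \<le> 1" using xz r(2) dist_triangle2[of x z y] by (simp add: dist_commute)
      then have "dist x z \<le> dist x z powr \<alpha>"
        using powr_mono'[of \<alpha> 1 "dist x z"] \<alpha> by (cases "x = z") auto
      then have "L * dist x z \<le> L * dist x z powr \<alpha>" using L(1) by (rule mult_left_mono)
      moreover have "\<bar>iter_partial is f x - iter_partial is f z\<bar> \<le> L * dist x z"
        using xz by (intro L(2)) auto
      ultimately show "\<bar>iter_partial is f x - iter_partial is f z\<bar> \<le> L * dist x z powr \<alpha>" by linarith
    qed
  qed
  moreover have "C_k k f (ball y r)"
    using Ck_ext_imp_C_k[OF open_ball Ck_ext_subset[OF Ck_ext_Suc_imp[OF f] sub sub]] .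
  ultimately show ?thesis using that r(1) sub by (auto simp: C_k_holder_def)
qed

section \<open>Domains below a Lipschitz graph\<close>

text \<open>The graph function lives on the full space and is constant along \<open>e\<close>, which
  replaces coordinates on the hyperplane. \<open>L\<close> fixes the aperture of the cones contained
  in \<open>W\<close>; the C^1 assumption starts the gain of derivatives.\<close>

locale local_graph =
  fixes W :: "(real^'n::finite) set" and x e :: "real^'n" and r :: real
    and \<gamma> :: "real^'n \<Rightarrow> real" and L :: real
  assumes open_W: "open W" and r_pos: "r > 0" and norm_e: "norm e = 1" and L_nonneg: "L \<ge> 0"
    and \<gamma>_add_e: "\<And>y s. \<gamma> (y + s *\<^sub>R e) = \<gamma> y"
    and \<gamma>_base: "\<gamma> x = 0"
    and \<gamma>_C1: "Ck_ext 1 \<gamma> (ball x r) (ball x r)"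
    and \<gamma>_lipschitz: "\<And>y z. y \<in> ball x r \<Longrightarrow> z \<in> ball x r \<Longrightarrow> \<bar>\<gamma> y - \<gamma> z\<bar> \<le> L * dist y z"
    and mem_W: "\<And>y. y \<in> ball x r \<Longrightarrow> y \<in> W \<longleftrightarrow> (y - x) \<bullet> e < \<gamma> y"
begin

lemma e_e: "e \<bullet> e = 1"
  using norm_e by (simp add: norm_eq_1)

text \<open>The step \<open>s *\<^sub>R u\<close> raises the height by at most
  \<open>s * \<delta>\<close> and lowers \<gamma> by at most \<open>L * (s * \<delta>)\<close>; the
  descent along \<open>e\<close> leaves \<gamma> unchanged. Of the factor \<open>L + 2\<close>,
  \<open>L + 1\<close> pays for these two losses and the remaining 1 makes the inequality
  strict.\<close>

lemma cone_mem:
  assumes y: "y \<in> ball x r" "(y - x) \<bullet> e \<le> \<gamma> y" and u: "norm u \<le> \<delta>" and pos: "0 < \<delta>" "0 < s"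
    and b: "y + s *\<^sub>R u \<in> ball x r" "y + s *\<^sub>R (u - ((L + 2) * \<delta>) *\<^sub>R e) \<in> ball x r"
  shows "y + s *\<^sub>R (u - ((L + 2) * \<delta>) *\<^sub>R e) \<in> W"
proof -
  let ?w = "y + s *\<^sub>R (u - ((L + 2) * \<delta>) *\<^sub>R e)"
  have "?w = (y + s *\<^sub>R u) + (- (s * ((L + 2) * \<delta>))) *\<^sub>R e"
    by (simp add: algebra_simps)
  then have "\<gamma> ?w = \<gamma> (y + s *\<^sub>R u)" by (metis \<gamma>_add_e)
  moreover have "\<bar>\<gamma> (y + s *\<^sub>R u) - \<gamma> y\<bar> \<le> L * (s * norm u)"
    using \<gamma>_lipschitz[OF b(1) y(1)] pos by (simp add: dist_norm)
  moreover have "L * (s * norm u) \<le> L * (s * \<delta>)"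
    using u pos L_nonneg by (intro mult_left_mono) auto
  ultimately have 1: "\<gamma> ?w \<ge> \<gamma> y - L * (s * \<delta>)" by linarith
  have "u \<bullet> e \<le> \<delta>" using norm_cauchy_schwarz[of u e] u norm_e by simp
  then have "s * (u \<bullet> e) \<le> s * \<delta>" using pos by simp
  moreover have "(?w - x) \<bullet> e = (y - x) \<bullet> e + s * (u \<bullet> e) - s * ((L + 2) * \<delta>)"
    using e_e by (simp add: inner_simps algebra_simps)
  ultimately have "(?w - x) \<bullet> e \<le> (y - x) \<bullet> e - L * (s * \<delta>) - s * \<delta>"
    by (simp add: algebra_simps)
  then have "(?w - x) \<bullet> e < \<gamma> ?w" using 1 y(2) pos by (smt (verit) mult_pos_pos)
  then show ?thesis using mem_W b(2) by blast
qed

lemma cone_mem_small: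
  assumes y: "y \<in> ball x r" "(y - x) \<bullet> e \<le> \<gamma> y" and u: "norm u \<le> \<delta>" and pos: "0 < \<delta>"
  obtains d where "d > 0" "\<And>s. 0 < s \<Longrightarrow> s \<le> d \<Longrightarrow> y + s *\<^sub>R (u - ((L + 2) * \<delta>) *\<^sub>R e) \<in> W"
proof -
  have *: "\<exists>d>0. \<forall>s. 0 < s \<and> s \<le> d \<longrightarrow> y + s *\<^sub>R v \<in> ball x r" for v
  proof -
    have "isCont (\<lambda>s. y + s *\<^sub>R v) 0" by (intro continuous_intros)
    then have "((\<lambda>s. y + s *\<^sub>R v) \<longlongrightarrow> y) (at 0)" by (simp add: isCont_def)
    then have "\<forall>\<^sub>F s in at 0. y + s *\<^sub>R v \<in> ball x r"
      using topological_tendstoD[of _ y "at 0" "ball x r"] y(1) by auto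
    then obtain d where d: "d > 0" "\<And>s. s \<noteq> 0 \<Longrightarrow> dist s 0 < d \<Longrightarrow> y + s *\<^sub>R v \<in> ball x r"
      by (auto simp: eventually_at)
    show ?thesis
      by (intro exI[of _ "d/2"] conjI allI impI d(2)) (use d(1) in auto)
  qed
  obtain d1 d2 where d: "d1 > 0" "d2 > 0" "\<And>s. 0 < s \<Longrightarrow> s \<le> d1 \<Longrightarrow> y + s *\<^sub>R u \<in> ball x r"
    "\<And>s. 0 < s \<Longrightarrow> s \<le> d2 \<Longrightarrow> y + s *\<^sub>R (u - ((L + 2) * \<delta>) *\<^sub>R e) \<in> ball x r"
    using * by metis
  show ?thesis
    by (rule that[of "min d1 d2"]) (use d pos y u cone_mem in auto)
qed

text \<open>The points strictly above the graph form an open set that misses \<open>W\<close>, hence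
  its closure. From a point on or below the graph the cone with \<open>u = 0\<close> leads straight
  down into \<open>W\<close>.\<close>

lemma mem_closure:
  assumes y: "y \<in> ball x r"
  shows "y \<in> closure W \<longleftrightarrow> (y - x) \<bullet> e \<le> \<gamma> y"
proof
  assume c: "y \<in> closure W"
  let ?U = "{y \<in> ball x r. \<gamma> y < (y - x) \<bullet> e}"
  have "continuous_on (ball x r) (\<lambda>y. (y - x) \<bullet> e - \<gamma> y)"
    using Ck_ext_imp_continuous_on[OF \<gamma>_C1] by (intro continuous_intros)
  then have "open (ball x r \<inter> (\<lambda>y. (y - x) \<bullet> e - \<gamma> y) -` {0<..})"
    by (rule continuous_open_preimage) auto
  moreover have "ball x r \<inter> (\<lambda>y. (y - x) \<bullet> e - \<gamma> y) -` {0<..} = ?U" by auto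
  ultimately have "open ?U" by simp
  moreover have "?U \<inter> W = {}" using mem_W by auto
  ultimately have "?U \<inter> closure W = {}" by (simp add: open_Int_closure_eq_empty)
  then show "(y - x) \<bullet> e \<le> \<gamma> y" using c y by fastforce
next
  assume "(y - x) \<bullet> e \<le> \<gamma> y"
  then obtain d where d: "d > 0" "\<And>s. 0 < s \<Longrightarrow> s \<le> d \<Longrightarrow> y + s *\<^sub>R (0 - ((L + 2) * 1) *\<^sub>R e) \<in> W"
    using cone_mem_small[OF y, of 0 1] by auto
  show "y \<in> closure W"
    unfolding closure_approachable
  proof (intro allI impI)
    fix \<epsilon> :: real assume "\<epsilon> > 0"
    let ?s = "min d (\<epsilon> / (2 * (L + 2)))"
    have "?s > 0" using d \<open>\<epsilon> > 0\<close> L_nonneg by simp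
    have "?s * (L + 2) \<le> \<epsilon> / (2 * (L + 2)) * (L + 2)" using L_nonneg by (intro mult_right_mono) auto
    also have "\<dots> = \<epsilon> / 2"
    proof -
      have "a / (2 * c) * c = a / 2" if "c \<noteq> 0" for a c :: real using that by simp
      from this[of "L + 2" \<epsilon>] show ?thesis using L_nonneg by linarith
    qed
    also have "\<dots> < \<epsilon>" using \<open>\<epsilon> > 0\<close> by simp
    finally have "dist (y + ?s *\<^sub>R (0 - ((L + 2) * 1) *\<^sub>R e)) y < \<epsilon>"
      using \<open>?s > 0\<close> L_nonneg norm_e by (simp add: dist_norm)
    moreover have "y + ?s *\<^sub>R (0 - ((L + 2) * 1) *\<^sub>R e) \<in> W"
      using \<open>?s > 0\<close> by (intro d(2)) auto
    ultimately show "\<exists>w\<in>W. dist w y < \<epsilon>" by blast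
  qed
qed

lemma mem_frontier:
  assumes y: "y \<in> ball x r"
  shows "y \<in> frontier W \<longleftrightarrow> (y - x) \<bullet> e = \<gamma> y"
  using mem_closure[OF y] mem_W[OF y] open_W by (auto simp: frontier_def interior_open)

section \<open>Derivatives relative to the closure\<close>

text \<open>After subtraction of the linear map at \<open>z\<close>, the mean value theorem along a
  path in \<open>W\<close> bounds the increment by the oscillation of \<open>F\<close>, which is
  small near \<open>z\<close> by continuity up to the closure.\<close>

lemma has_derivative_within_closure:
  assumes h: "continuous_on (closure W) h"
    and F: "\<And>y. y \<in> W \<Longrightarrow> (h has_derivative (\<lambda>v. F y \<bullet> v)) (at y)" "continuous_on (closure W) F"
    and z: "z \<in> closure W" "z \<in> ball x r"
  shows "(h has_derivative (\<lambda>v. F z \<bullet> v)) (at z within closure W)"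
  unfolding has_derivative_within_alt
proof (intro conjI allI impI)
  show "bounded_linear (\<lambda>v. F z \<bullet> v)" by (rule bounded_linear_inner_right)
  fix \<epsilon> :: real assume "\<epsilon> > 0"
  define K where "K = L + 2"
  have K: "K > 0" using L_nonneg by (simp add: K_def)
  \<comment> \<open>The path from \<open>y\<close> through \<open>q\<close> to \<open>z\<close> has
    length at most \<open>2 * K + 1\<close> times the distance of \<open>y\<close> and
    \<open>z\<close>: \<open>K + 1\<close> for the first leg, \<open>K\<close> for the
    second.\<close>
  define \<epsilon>' where "\<epsilon>' = \<epsilon> / (2 * K + 1)"
  have \<epsilon>': "\<epsilon>' > 0" "\<epsilon>' * (2 * K + 1) = \<epsilon>" using K \<open>\<epsilon> > 0\<close> by (auto simp: \<epsilon>'_def)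
  obtain d1 where d1: "d1 > 0" "\<And>y. y \<in> closure W \<Longrightarrow> dist y z < d1 \<Longrightarrow> dist (F y) (F z) < \<epsilon>'"
    using F(2) z(1) \<epsilon>'(1) unfolding continuous_on_iff by metis
  define d2 where "d2 = r - dist x z"
  have d2: "d2 > 0" using z(2) by (simp add: d2_def)
  have inball: "w \<in> ball x r" if "dist w z < d2" for w
    using that dist_triangle[of x w z] by (simp add: d2_def dist_commute)
  define d where "d = min d1 d2 / (K + 1)"
  have d: "d > 0" "(K + 1) * d \<le> d1" "(K + 1) * d \<le> d2" using d1 d2 K by (auto simp: d_def)
  define H where "H w = h w - F z \<bullet> w" for w
  have "norm (h y - h z - F z \<bullet> (y - z)) \<le> \<epsilon> * norm (y - z)" 
    if y: "y \<in> closure W" "norm (y - z) < d" for y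
  proof (cases "y = z")
    case False
    define \<delta> where "\<delta> = norm (y - z)"
    have \<delta>: "\<delta> > 0" "\<delta> < d" using False y(2) by (auto simp: \<delta>_def)
    have big: "(K + 1) * \<delta> < (K + 1) * d" using \<delta> K by simp
    \<comment> \<open>The segment from \<open>y\<close> to \<open>z\<close> may leave \<open>W\<close>; the path through \<open>q\<close> does not and has length \<open>O(\<delta>)\<close>.\<close>
    define q where "q = z - (K * \<delta>) *\<^sub>R e"
    \<comment> \<open>One estimate for both legs, used with \<open>y' = y\<close> and
      \<open>y' = z\<close>.\<close>
    have *: "\<bar>H q - H y'\<bar> \<le> \<epsilon>' * norm (q - y')" if y': "y' \<in> closure W" "norm (z - y') \<le> \<delta>" for y'
    proof -
      define w where "w s = y' + s *\<^sub>R (q - y')" for s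
      \<comment> \<open>In this form \<open>w s\<close> is the cone point at \<open>y'\<close> with
        \<open>u = z - y'\<close>, so the leg lies in \<open>W\<close> for
        \<open>s > 0\<close>.\<close>
      have w: "w s = y' + s *\<^sub>R ((z - y') - (K * \<delta>) *\<^sub>R e)" for s
        by (simp add: w_def q_def algebra_simps)
      have dw: "norm (w s - z) \<le> (K + 1) * \<delta>" if s: "0 \<le> s" "s \<le> 1" for s
      proof -
        have "w s - z = (1 - s) *\<^sub>R (y' - z) - (s * (K * \<delta>)) *\<^sub>R e" by (simp add: w algebra_simps)
        also have "norm \<dots> \<le> norm ((1 - s) *\<^sub>R (y' - z)) + norm ((s * (K * \<delta>)) *\<^sub>R e)" by (rule norm_triangle_ineq4)
        also have "\<dots> = (1 - s) * norm (z - y') + s * (K * \<delta>)" using s K \<delta> norm_e by (simp add: norm_minus_commute)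
        also have "\<dots> \<le> 1 * \<delta> + 1 * (K * \<delta>)" using s K \<delta> y'(2) by (intro add_mono mult_mono) auto
        finally show ?thesis by (simp add: algebra_simps)
      qed
      have wb: "w s \<in> ball x r" if "0 \<le> s" "s \<le> 1" for s
        using dw[OF that] big d by (intro inball) (simp add: dist_norm)
      have y'b: "y' \<in> ball x r" using wb[of 0] by (simp add: w_def)
      have wW: "w s \<in> W" if s: "0 < s" "s \<le> 1" for s
      proof -
        have "dist (y' + s *\<^sub>R (z - y')) z = (1 - s) * norm (z - y')"
        proof -
          have "y' + s *\<^sub>R (z - y') - z = (1 - s) *\<^sub>R (y' - z)" by (simp add: algebra_simps)
          then show ?thesis using s by (simp add: dist_norm norm_minus_commute)
        qed
        also have "\<dots> \<le> 1 * \<delta>" using s y'(2) by (intro mult_mono) auto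
        also have "\<dots> < d2"
        proof -
          have "\<delta> \<le> (K + 1) * \<delta>" using K \<delta> by (simp add: algebra_simps)
          then show ?thesis using big d by linarith
        qed
        finally have "y' + s *\<^sub>R (z - y') \<in> ball x r" by (rule inball)
        then show ?thesis
          using cone_mem[OF y'b _ y'(2) \<delta>(1) s(1)] wb[of s] s mem_closure[OF y'b] y'(1)
          by (simp add: w K_def)
      qed
      have w01: "w ` {0..1} \<subseteq> closure W"
      proof safe
        fix s :: real assume "s \<in> {0..1}"
        then show "w s \<in> closure W"
          using wW[of s] closure_subset[of W] y'(1) by (cases "s = 0") (auto simp: w_def)
      qed
      have contw: "continuous_on {0..1} w" unfolding w_def by (intro continuous_intros)
      have "continuous_on {0..1} (\<lambda>s. H (w s))"
        unfolding H_def
        by (intro continuous_intros contw continuous_on_compose2[OF h contw w01])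
      moreover have "((\<lambda>s. H (w s)) has_derivative (\<lambda>t. t * ((F (w s) - F z) \<bullet> (q - y')))) (at s)"
        if s: "0 < s" "s < 1" for s
      proof -
        have dw: "(w has_derivative (\<lambda>t. t *\<^sub>R (q - y'))) (at s)" unfolding w_def by (auto intro!: derivative_eq_intros)
        have "((\<lambda>s. h (w s)) has_derivative (\<lambda>t. F (w s) \<bullet> (t *\<^sub>R (q - y')))) (at s)"
          using has_derivative_compose[OF dw F(1)[OF wW[of s]]] s by simp
        moreover have "((\<lambda>s. F z \<bullet> w s) has_derivative (\<lambda>t. F z \<bullet> (t *\<^sub>R (q - y')))) (at s)"
          using has_derivative_inner_right[OF dw] .
        ultimately show ?thesis unfolding H_def
          by (rule has_derivative_eq_rhs[OF has_derivative_diff]) (simp add: fun_eq_iff inner_diff_left right_diff_distrib)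
      qed
      ultimately obtain \<xi> where \<xi>: "\<xi> \<in> {0<..<1}" "H (w 1) - H (w 0) = (1 - 0) * ((F (w \<xi>) - F z) \<bullet> (q - y'))"
        using mvt[of 0 1 "\<lambda>s. H (w s)" "\<lambda>s t. t * ((F (w s) - F z) \<bullet> (q - y'))"] by auto
      have "norm (F (w \<xi>) - F z) \<le> \<epsilon>'"
      proof -
        have "w \<xi> \<in> closure W" using \<xi>(1) w01 by auto
        moreover have "dist (w \<xi>) z < d1" using dw[of \<xi>] big d(2) \<xi>(1) by (simp add: dist_norm)
        ultimately show ?thesis using d1(2) by (simp add: dist_norm less_imp_le)
      qed
      then have "\<bar>(F (w \<xi>) - F z) \<bullet> (q - y')\<bar> \<le> \<epsilon>' * norm (q - y')"
        by (meson Cauchy_Schwarz_ineq2 mult_right_mono norm_ge_zero order_trans)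
      then show ?thesis using \<xi>(2) by (simp add: w_def)
    qed
    have nq: "norm (q - z) = K * \<delta>" using K \<delta> norm_e by (simp add: q_def)
    have "norm (q - y) \<le> norm (q - z) + norm (z - y)" by (metis norm_triangle_ineq diff_add_cancel add_diff_eq)
    then have nq2: "norm (q - y) \<le> K * \<delta> + \<delta>" using nq by (simp add: \<delta>_def norm_minus_commute)
    have "\<bar>H q - H y\<bar> \<le> \<epsilon>' * norm (q - y)" "\<bar>H q - H z\<bar> \<le> \<epsilon>' * norm (q - z)"
      using *[OF y(1)] *[OF z(1)] \<delta> by (auto simp: \<delta>_def norm_minus_commute)
    then have "\<bar>H y - H z\<bar> \<le> \<epsilon>' * norm (q - y) + \<epsilon>' * norm (q - z)" by linarith
    also have "\<dots> \<le> \<epsilon>' * (K * \<delta> + \<delta>) + \<epsilon>' * (K * \<delta>)"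
      using nq nq2 \<epsilon>' by (intro add_mono mult_left_mono) auto
    also have "\<dots> = (\<epsilon>' * (2 * K + 1)) * \<delta>" by (simp add: algebra_simps)
    also have "\<dots> = \<epsilon> * \<delta>" using \<epsilon>'(2) by simp
    finally show ?thesis by (simp add: H_def \<delta>_def inner_diff_right algebra_simps)
  qed simp
  then show "\<exists>d>0. \<forall>y\<in>closure W. norm (y - z) < d \<longrightarrow> norm (h y - h z - F z \<bullet> (y - z)) \<le> \<epsilon> * norm (y - z)"
    using d(1) by blast
qed

text \<open>The directions \<open>v - ((L + 2) * (norm u + 1)) *\<^sub>R e\<close> point into
  \<open>W\<close>, so \<open>A\<close> and \<open>B\<close> agree on them; subtracting the case
  \<open>v = 0\<close> from \<open>v = u\<close> leaves \<open>u\<close>. The added 1 keeps the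
  aperture positive when \<open>u = 0\<close>.\<close>

lemma derivative_within_closure_unique:
  fixes h :: "real^'n \<Rightarrow> 'b::real_normed_vector"
  assumes A: "(h has_derivative A) (at z within closure W)" and B: "(h has_derivative B) (at z within closure W)"
    and z: "z \<in> closure W" "z \<in> ball x r"
  shows "A = B"
proof
  fix u :: "real^'n"
  have cone: "A (v - ((L + 2) * (norm u + 1)) *\<^sub>R e) = B (v - ((L + 2) * (norm u + 1)) *\<^sub>R e)"
    if v: "norm v \<le> norm u + 1" for v
  proof -
    have p: "0 < norm u + 1" by (simp add: add_nonneg_pos)
    obtain d where d: "d > 0"
      "\<And>s. 0 < s \<Longrightarrow> s \<le> d \<Longrightarrow> z + s *\<^sub>R (v - ((L + 2) * (norm u + 1)) *\<^sub>R e) \<in> W"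
      using cone_mem_small[OF z(2) _ v p] mem_closure[OF z(2)] z(1) by metis
    show ?thesis
    proof (rule has_derivative_along_ray_unique[OF A B d(1)])
      show "z + s *\<^sub>R (v - ((L + 2) * (norm u + 1)) *\<^sub>R e) \<in> closure W" if "0 \<le> s" "s \<le> d" for s
        using d(2)[of s] that z(1) closure_subset[of W] by (cases "s = 0") auto
    qed
  qed
  have l: "linear A" "linear B" using A B by (auto intro: has_derivative_linear)
  show "A u = B u"
    using cone[of u] cone[of 0] l by (simp add: linear_diff linear_neg)
qed

section \<open>Traces on the graph\<close>

text \<open>Projection onto the graph along \<open>e\<close>: the height of \<open>y\<close> is
  replaced by \<open>\<gamma> y\<close>. Traces on the boundary thereby become functions on an open
  ball.\<close>

definition lift :: "real^'n \<Rightarrow> real^'n" where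
  "lift y = y + (\<gamma> y - (y - x) \<bullet> e) *\<^sub>R e"

lemma lift_base: "lift x = x"
  by (simp add: lift_def \<gamma>_base)

lemma small_ball_subset: "ball x (r / (L + 2)) \<subseteq> ball x r"
proof -
  have "r / (L + 2) \<le> r / 1" using r_pos L_nonneg by (intro divide_left_mono) auto
  then show ?thesis by (simp add: subset_ball)
qed

text \<open>\<open>lift\<close> enlarges the distance from \<open>x\<close> by at most the factor
  \<open>L + 2\<close>: 1 for \<open>y\<close> itself, \<open>L\<close> for \<gamma> and 1 for the
  removed height. Hence the radius \<open>r / (L + 2)\<close>.\<close>

lemma lift_in_ball:
  assumes "y \<in> ball x (r / (L + 2))"
  shows "lift y \<in> ball x r"
proof -
  have y: "y \<in> ball x r" using assms small_ball_subset by auto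
  have "\<bar>\<gamma> y\<bar> \<le> L * norm (y - x)"
    using \<gamma>_lipschitz[OF y, of x] r_pos by (simp add: \<gamma>_base dist_norm)
  moreover have "\<bar>(y - x) \<bullet> e\<bar> \<le> norm (y - x)"
    using Cauchy_Schwarz_ineq2[of "y - x" e] norm_e by simp
  moreover have "norm (lift y - x) \<le> norm (y - x) + \<bar>\<gamma> y - (y - x) \<bullet> e\<bar>"
  proof -
    have "lift y - x = (y - x) + (\<gamma> y - (y - x) \<bullet> e) *\<^sub>R e" by (simp add: lift_def)
    then have "norm (lift y - x) \<le> norm (y - x) + norm ((\<gamma> y - (y - x) \<bullet> e) *\<^sub>R e)"
      by (metis norm_triangle_ineq)
    then show ?thesis using norm_e by simp
  qed
  ultimately have "norm (lift y - x) \<le> (L + 2) * norm (y - x)"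
    by (simp add: algebra_simps)
  also have "\<dots> < r"
  proof -
    have "norm (y - x) < r / (L + 2)" using assms by (simp add: dist_norm norm_minus_commute)
    then show ?thesis using L_nonneg by (simp add: pos_less_divide_eq mult.commute)
  qed
  finally show ?thesis by (simp add: dist_norm norm_minus_commute)
qed

lemma lift_in_frontier:
  assumes "y \<in> ball x (r / (L + 2))"
  shows "lift y \<in> frontier W" "lift y \<in> closure W"
proof -
  have "(lift y - x) \<bullet> e = \<gamma> y" using e_e by (simp add: lift_def inner_simps algebra_simps)
  then show "lift y \<in> frontier W"
    using mem_frontier[OF lift_in_ball[OF assms]] by (simp add: lift_def \<gamma>_add_e)
  then show "lift y \<in> closure W" by (simp add: frontier_def)
qed

lemma lift_has_derivative:
  assumes "(\<gamma> has_derivative (\<lambda>v. \<Gamma> \<bullet> v)) (at y)"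
  shows "(lift has_derivative (\<lambda>v. v + (\<Gamma> \<bullet> v - e \<bullet> v) *\<^sub>R e)) (at y)"
proof -
  have "((\<lambda>y. y + (\<gamma> y - (y - x) \<bullet> e) *\<^sub>R e) has_derivative (\<lambda>v. v + (\<Gamma> \<bullet> v - e \<bullet> v) *\<^sub>R e)) (at y)"
    using assms by (auto intro!: derivative_eq_intros simp: inner_commute)
  then show ?thesis unfolding lift_def[abs_def] .
qed

text \<open>Since \<open>lift\<close> sends the ball into \<open>closure W\<close>, the chain rule
  needs the derivative of \<open>h\<close> only relative to the closure.\<close>

lemma has_derivative_comp_lift:
  assumes h: "(h has_derivative (\<lambda>v. F \<bullet> v)) (at (lift y) within closure W)"
    and y: "y \<in> ball x (r / (L + 2))" and \<Gamma>: "(\<gamma> has_derivative (\<lambda>v. \<Gamma> \<bullet> v)) (at y)"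
  shows "((\<lambda>y. h (lift y)) has_derivative (\<lambda>v. (F + (F \<bullet> e) *\<^sub>R (\<Gamma> - e)) \<bullet> v)) (at y)"
proof -
  let ?B = "ball x (r / (L + 2))"
  have at: "at y within ?B = at y" by (rule at_within_open[OF y open_ball])
  have "lift ` ?B \<subseteq> closure W" using lift_in_frontier by auto
  then have "(h has_derivative (\<lambda>v. F \<bullet> v)) (at (lift y) within lift ` ?B)"
    by (rule has_derivative_subset[OF h])
  from has_derivative_in_compose[OF has_derivative_at_withinI[OF lift_has_derivative[OF \<Gamma>]] this]
  have "((\<lambda>y. h (lift y)) has_derivative (\<lambda>v. F \<bullet> (v + (\<Gamma> \<bullet> v - e \<bullet> v) *\<^sub>R e))) (at y)"
    unfolding at .
  then show ?thesis by (simp add: inner_simps algebra_simps)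
qed

text \<open>The trace of \<open>h\<close> is identically zero, so its chain-rule gradient vanishes.
  Solved for \<Gamma>, the identity is the formula for the gradient of \<gamma>.\<close>

lemma gradient_vanishing_on_frontier:
  assumes h: "(h has_derivative (\<lambda>v. F \<bullet> v)) (at (lift y) within closure W)"
    and y: "y \<in> ball x (r / (L + 2))" and \<Gamma>: "(\<gamma> has_derivative (\<lambda>v. \<Gamma> \<bullet> v)) (at y)"
    and h0: "\<And>z. z \<in> frontier W \<inter> ball x r \<Longrightarrow> h z = 0"
  shows "F + (F \<bullet> e) *\<^sub>R (\<Gamma> - e) = 0"
proof -
  have "((\<lambda>y. h (lift y)) has_derivative (\<lambda>v. 0)) (at y)"
    by (rule has_derivative_transform_within_open[OF has_derivative_const open_ball y])
      (use h0 lift_in_frontier lift_in_ball in auto)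
  then have "((\<lambda>y. h (lift y)) has_derivative (\<lambda>v. 0 \<bullet> v)) (at y)" by simp
  then show ?thesis
    using gradient_unique has_derivative_comp_lift[OF h y \<Gamma>] by blast
qed

lemma \<gamma>_differentiable:
  obtains \<Gamma> where "\<And>y. y \<in> ball x r \<Longrightarrow> (\<gamma> has_derivative (\<lambda>v. \<Gamma> y \<bullet> v)) (at y)"
  using \<gamma>_C1 unfolding One_nat_def by (rule Ck_ext_SucE) blast

text \<open>If \<open>F \<bullet> e\<close> were 0, \<open>gradient_vanishing_on_frontier\<close> at
  \<open>x = lift x\<close> would read \<open>F = 0\<close>.\<close>

lemma gradient_e_nonzero:
  assumes h: "(h has_derivative (\<lambda>v. F \<bullet> v)) (at x within closure W)"
    and h0: "\<And>z. z \<in> frontier W \<inter> ball x r \<Longrightarrow> h z = 0" and "F \<noteq> 0"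
  shows "F \<bullet> e \<noteq> 0"
proof -
  obtain \<Gamma> where \<Gamma>: "(\<gamma> has_derivative (\<lambda>v. \<Gamma> \<bullet> v)) (at x)"
    using \<gamma>_differentiable r_pos by (metis centre_in_ball)
  have x: "x \<in> ball x (r / (L + 2))" using r_pos L_nonneg by simp
  have "F + (F \<bullet> e) *\<^sub>R (\<Gamma> - e) = 0"
    by (rule gradient_vanishing_on_frontier[OF _ x \<Gamma> h0]) (use h in \<open>simp_all add: lift_base\<close>)
  then show ?thesis using assms(3) by auto
qed

section \<open>Regularity of traces and of the graph\<close>

lemma continuous_on_lift: "continuous_on (ball x r) lift"
  unfolding lift_def using Ck_ext_imp_continuous_on[OF \<gamma>_C1] by (intro continuous_intros)

lemma continuous_on_comp_lift:
  assumes "continuous_on (closure W) F" "B \<subseteq> ball x (r / (L + 2))"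
  shows "continuous_on B (\<lambda>y. F (lift y))"
  by (rule continuous_on_compose2[OF assms(1) continuous_on_subset[OF continuous_on_lift]])
    (use assms(2) small_ball_subset lift_in_frontier in auto)

text \<open>The gradient of the trace is built from the trace of \<open>F\<close> and the gradient
  of \<gamma>. Both have class \<open>k\<close>: the first by induction, the second because \<gamma>
  has class \<open>Suc k\<close>.\<close>

lemma Ck_ext_comp_lift:
  assumes B: "open B" "B \<subseteq> ball x (r / (L + 2))"
  shows "Ck_ext k h W (closure W) \<Longrightarrow> Ck_ext k \<gamma> B B \<Longrightarrow> Ck_ext k (\<lambda>y. h (lift y)) B B"
proof (induction k arbitrary: h)
  case 0
  then show ?case using continuous_on_comp_lift B by simp
next
  case (Suc k)
  from Suc.prems(1) obtain F where F: "continuous_on (closure W) h"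
    "\<And>y. y \<in> W \<Longrightarrow> (h has_derivative (\<lambda>v. F y \<bullet> v)) (at y)"
    "\<And>i. Ck_ext k (\<lambda>y. F y $ i) W (closure W)" by (auto elim!: Ck_ext_SucE simp del: Ck_ext.simps)
  have contF: "continuous_on (closure W) F"
    using F(3) Ck_ext_imp_continuous_on continuous_on_vec_components by blast
  from Suc.prems(2) obtain \<Gamma> where \<Gamma>: "\<And>y. y \<in> B \<Longrightarrow> (\<gamma> has_derivative (\<lambda>v. \<Gamma> y \<bullet> v)) (at y)"
    "\<And>i. Ck_ext k (\<lambda>y. \<Gamma> y $ i) B B" by (auto elim!: Ck_ext_SucE simp del: Ck_ext.simps)
  have \<gamma>k: "Ck_ext k \<gamma> B B" using Suc.prems(2) by (rule Ck_ext_Suc_imp)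
  show ?case
  proof (rule Ck_ext_SucI[where F = "\<lambda>y. F (lift y) + (F (lift y) \<bullet> e) *\<^sub>R (\<Gamma> y - e)"])
    show "continuous_on B (\<lambda>y. h (lift y))" by (rule continuous_on_comp_lift[OF F(1) B(2)])
    show "((\<lambda>y. h (lift y)) has_derivative (\<lambda>v. (F (lift y) + (F (lift y) \<bullet> e) *\<^sub>R (\<Gamma> y - e)) \<bullet> v)) (at y)"
      if y: "y \<in> B" for y
    proof -
      have y': "y \<in> ball x (r / (L + 2))" using y B by auto
      show ?thesis
        by (rule has_derivative_comp_lift[OF has_derivative_within_closure[OF F(1,2) contF] y' \<Gamma>(1)[OF y]])
          (use y' lift_in_frontier lift_in_ball in auto)
    qed
    show "Ck_ext k (\<lambda>y. (F (lift y) + (F (lift y) \<bullet> e) *\<^sub>R (\<Gamma> y - e)) $ i) B B" for i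
      unfolding inner_vec_def vector_add_component vector_scaleR_component vector_minus_component
        real_scaleR_def inner_real_def
      by (intro Ck_ext_add Ck_ext_mult Ck_ext_diff Ck_ext_sum Ck_ext_const Suc.IH[OF F(3) \<gamma>k] \<Gamma>(2))
  qed
qed

text \<open>Each step gains one order: with \<gamma> of class \<open>k\<close>, the trace of the
  gradient of \<open>h\<close> has class \<open>k\<close>, and the gradient of \<gamma> is a
  rational expression in that trace with nonvanishing denominator.\<close>

lemma \<gamma>_Ck_ext:
  assumes B: "open B" "B \<subseteq> ball x (r / (L + 2))"
    and h0: "\<And>z. z \<in> frontier W \<inter> ball x r \<Longrightarrow> h z = 0"
    and F: "\<And>y. y \<in> W \<Longrightarrow> (h has_derivative (\<lambda>v. F y \<bullet> v)) (at y)" "continuous_on (closure W) F"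
    and nz: "\<And>y. y \<in> B \<Longrightarrow> F (lift y) \<bullet> e \<noteq> 0"
  shows "Ck_ext k h W (closure W) \<Longrightarrow> Ck_ext k \<gamma> B B"
proof (induction k)
  case 0
  have "B \<subseteq> ball x r" using B small_ball_subset by auto
  then show ?case using Ck_ext_imp_continuous_on[OF \<gamma>_C1] continuous_on_subset by auto
next
  case (Suc k)
  note \<gamma>k = Suc.IH[OF Ck_ext_Suc_imp[OF Suc.prems]]
  from Suc.prems obtain F' where F': "continuous_on (closure W) h"
    "\<And>y. y \<in> W \<Longrightarrow> (h has_derivative (\<lambda>v. F' y \<bullet> v)) (at y)"
    "\<And>i. Ck_ext k (\<lambda>y. F' y $ i) W (closure W)" by (auto elim!: Ck_ext_SucE simp del: Ck_ext.simps)
  have "continuous_on (closure W) F'"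
    using F'(3) Ck_ext_imp_continuous_on continuous_on_vec_components by blast
  moreover have "F' y = F y" if "y \<in> W" for y
    using gradient_unique[OF F'(2)[OF that] F(1)[OF that]] .
  \<comment> \<open>The nonvanishing assumption concerns the fixed \<open>F\<close>. The two
    gradients agree on the open set \<open>W\<close> and are continuous on its closure, so they
    agree there too.\<close>
  ultimately have eq: "F' y = F y" if "y \<in> closure W" for y
    using continuous_constant_on_closure[of W "\<lambda>y. F' y - F y" 0 y] that F(2)
    by (simp add: continuous_on_diff)
  have Fi: "Ck_ext k (\<lambda>y. F y $ i) W (closure W)" for i
    by (rule Ck_ext_cong[OF open_W closure_subset _ F'(3)]) (simp add: eq)
  have Fl: "Ck_ext k (\<lambda>y. F (lift y) $ i) B B" for i
    by (rule Ck_ext_comp_lift[OF B Fi \<gamma>k])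
  let ?\<Gamma> = "\<lambda>y. e - inverse (F (lift y) \<bullet> e) *\<^sub>R F (lift y)"
  have Br: "B \<subseteq> ball x r" using B small_ball_subset by auto
  show ?case
  proof (rule Ck_ext_SucI[where F = ?\<Gamma>])
    show "continuous_on B \<gamma>" using \<gamma>k by (rule Ck_ext_imp_continuous_on)
    show "(\<gamma> has_derivative (\<lambda>v. ?\<Gamma> y \<bullet> v)) (at y)" if y: "y \<in> B" for y
    proof -
      have y': "y \<in> ball x (r / (L + 2))" using y B by auto
      obtain \<Gamma> where \<Gamma>: "(\<gamma> has_derivative (\<lambda>v. \<Gamma> \<bullet> v)) (at y)"
        using \<gamma>_differentiable Br y by (metis subsetD)
      have "F (lift y) + (F (lift y) \<bullet> e) *\<^sub>R (\<Gamma> - e) = 0"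
        by (rule gradient_vanishing_on_frontier[OF has_derivative_within_closure[OF F'(1) F] y' \<Gamma> h0])
          (use y' lift_in_frontier lift_in_ball in auto)
      then have "inverse (F (lift y) \<bullet> e) *\<^sub>R (F (lift y) + (F (lift y) \<bullet> e) *\<^sub>R (\<Gamma> - e)) = 0" by simp
      then have "inverse (F (lift y) \<bullet> e) *\<^sub>R F (lift y) + (\<Gamma> - e) = 0"
        using nz[OF y] by (simp add: scaleR_add_right del: scaleR_eq_0_iff)
      then have "\<Gamma> = ?\<Gamma> y" by (simp add: add_eq_0_iff algebra_simps)
      then show ?thesis using \<Gamma> by simp
    qed
    have "Ck_ext k (\<lambda>y. F (lift y) \<bullet> e) B B"
      unfolding inner_vec_def inner_real_def by (intro Ck_ext_mult Ck_ext_sum Ck_ext_const Fl)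
    then have "Ck_ext k (\<lambda>y. inverse (F (lift y) \<bullet> e)) B B"
      by (rule Ck_ext_inverse[rotated 2]) (use nz in auto)
    then show "Ck_ext k (\<lambda>y. ?\<Gamma> y $ i) B B" for i
      unfolding vector_scaleR_component vector_minus_component real_scaleR_def
      by (intro Ck_ext_diff Ck_ext_mult Ck_ext_const Fl)
  qed
qed

text \<open>One direction \<open>e\<close> serves all boundary points near \<open>x\<close>. Moving
  the base point to \<open>y\<close> only subtracts the constant height
  \<open>(y - x) \<bullet> e\<close>, which is why \<open>R\<close> is asked of
  \<open>\<gamma> z - c\<close>.\<close>

lemma boundary_regular_in_ball:
  assumes \<rho>: "0 < \<rho>" "\<rho> \<le> r"
    and R: "\<And>y c. y \<in> ball x \<rho> \<Longrightarrow> \<exists>r'>0. ball y r' \<subseteq> ball x \<rho> \<and> R (\<lambda>z. \<gamma> z - c) (ball y r')"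
  shows "boundary_regular_in R W (ball x \<rho>)"
  unfolding boundary_regular_in_def boundary_regular_at_def
proof
  fix y assume y: "y \<in> frontier W \<inter> ball x \<rho>"
  obtain r' where r': "r' > 0" "ball y r' \<subseteq> ball x \<rho>" "R (\<lambda>z. \<gamma> z - (y - x) \<bullet> e) (ball y r')"
    using R y by blast
  have "z \<in> W \<longleftrightarrow> (z - y) \<bullet> e < \<gamma> (z - ((z - y) \<bullet> e) *\<^sub>R e) - (y - x) \<bullet> e" if "z \<in> ball y r'" for z
  proof -
    have "z \<in> ball x r" using that r'(2) \<rho>(2) by (auto simp: subset_iff)
    moreover have "\<gamma> (z - ((z - y) \<bullet> e) *\<^sub>R e) = \<gamma> z"
      using \<gamma>_add_e[of z "- ((z - y) \<bullet> e)"] by simp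
    ultimately show ?thesis using mem_W[of z] by (simp add: inner_diff_left algebra_simps)
  qed
  then show "\<exists>r>0. \<exists>e g. norm e = 1 \<and> R g (ball y r) \<and>
        (\<forall>z\<in>ball y r. (z \<in> W) = ((z - y) \<bullet> e < g (z - ((z - y) \<bullet> e) *\<^sub>R e)))"
    using r' norm_e by blast
qed

text \<open>The ball depends only on where the first gradient is transversal to \<open>e\<close>, so
  a single \<rho> serves all orders \<open>k\<close>; the smooth class relies on this.\<close>

lemma \<gamma>_Ck_ext_near:
  assumes h: "continuous_on (closure W) h" "\<And>z. z \<in> frontier W \<inter> ball x r \<Longrightarrow> h z = 0"
    and F: "\<And>y. y \<in> W \<Longrightarrow> (h has_derivative (\<lambda>v. F y \<bullet> v)) (at y)" "continuous_on (closure W) F"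
    and x: "x \<in> closure W" "F x \<noteq> 0"
  obtains \<rho> where "\<rho> > 0" "\<rho> \<le> r"
    "\<And>k. Ck_ext k h W (closure W) \<Longrightarrow> Ck_ext k \<gamma> (ball x \<rho>) (ball x \<rho>)"
proof -
  let ?\<rho> = "r / (L + 2)"
  have \<rho>: "?\<rho> > 0" using r_pos L_nonneg by simp
  have "(h has_derivative (\<lambda>v. F x \<bullet> v)) (at x within closure W)"
    using has_derivative_within_closure[OF h(1) F x(1)] r_pos by simp
  then have "F (lift x) \<bullet> e \<noteq> 0" using gradient_e_nonzero h(2) x(2) lift_base by auto
  moreover have "continuous_on (ball x ?\<rho>) (\<lambda>y. F (lift y) \<bullet> e)"
    by (intro continuous_intros continuous_on_comp_lift F(2) order_refl)
  then have "open (ball x ?\<rho> \<inter> (\<lambda>y. F (lift y) \<bullet> e) -` (- {0}))"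
    by (rule continuous_open_preimage) auto
  ultimately obtain \<rho> where "\<rho> > 0" "ball x \<rho> \<subseteq> ball x ?\<rho> \<inter> (\<lambda>y. F (lift y) \<bullet> e) -` (- {0})"
    using \<rho> unfolding open_contains_ball by (metis IntI vimageI Compl_iff singletonD centre_in_ball)
  note \<rho>' = this
  show ?thesis
  proof (rule that)
    show "\<rho> > 0" by fact
    show "\<rho> \<le> r" using \<rho>' small_ball_subset ball_subset_ball_iff[of x \<rho> x r] by auto
    show "Ck_ext k \<gamma> (ball x \<rho>) (ball x \<rho>)" if "Ck_ext k h W (closure W)" for k
      by (rule \<gamma>_Ck_ext[OF open_ball _ h(2) F _ that]) (use \<rho>' in auto)
  qed
qed

text \<open>\<open>frechet_derivative\<close> is a choice among derivatives; uniqueness relative to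
  the closure makes it the identity. As \<open>x\<close> is its own preimage, the Jacobian in the
  coefficient is the one at \<open>x\<close>.\<close>

lemma push_forward_coeff_eq_mat_1:
  assumes D: "\<And>i. ((\<lambda>y. \<Psi> y $ i - y $ i) has_derivative (\<lambda>v. 0)) (at x within closure W)"
    and inj: "inj_on \<Psi> (closure W)" and x: "x \<in> closure W" "\<Psi> x = x"
  shows "push_forward_coeff W \<Psi> x = mat 1"
proof -
  have "((\<lambda>y. \<Psi> y $ i) has_derivative (\<lambda>v. v $ i)) (at x within closure W)" for i
    using has_derivative_add[OF D[of i]
      bounded_linear.has_derivative[OF bounded_linear_vec_nth[of i] has_derivative_ident]] by simp
  then have \<Psi>: "(\<Psi> has_derivative (\<lambda>v. v)) (at x within closure W)"
    unfolding has_derivative_componentwise_within[of \<Psi>] by (auto simp: Basis_vec_def inner_axis)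
  then have "\<Psi> differentiable (at x within closure W)" by (auto simp: differentiable_def)
  then have "(\<Psi> has_derivative frechet_derivative \<Psi> (at x within closure W)) (at x within closure W)"
    by (simp add: frechet_derivative_works)
  from derivative_within_closure_unique[OF this \<Psi> x(1)]
  have "frechet_derivative \<Psi> (at x within closure W) = (\<lambda>v. v)" using r_pos by simp
  moreover have "inv_into (closure W) \<Psi> x = x" using inv_into_f_f[OF inj x(1)] x(2) by simp
  moreover have "matrix (\<lambda>v::real^'n. v) = mat 1" using matrix_id_mat_1 by (simp add: id_def)
  ultimately show ?thesis
    by (simp add: push_forward_coeff_def jacobian_closure_def)
qed

end

section \<open>From a regular boundary point to a local graph\<close>

lemma norm_diff_proj_le:
  fixes u e :: "'a::real_inner"
  assumes "norm e = 1"
  shows "norm (u - (u \<bullet> e) *\<^sub>R e) \<le> norm u"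
proof -
  have "e \<bullet> e = 1" using assms by (simp add: norm_eq_1)
  then have "(u - (u \<bullet> e) *\<^sub>R e) \<bullet> (u - (u \<bullet> e) *\<^sub>R e) = u \<bullet> u - (u \<bullet> e)\<^sup>2"
    by (simp add: inner_diff_left inner_diff_right inner_commute[of e u] power2_eq_square)
  then show ?thesis by (simp add: norm_le)
qed

text \<open>Composition with the projection \<open>p\<close> makes \<open>g\<close> constant along
  \<open>e\<close>, and \<open>p\<close> does not leave the ball because it does not increase the
  distance from \<open>x\<close>.\<close>

lemma boundary_regular_imp_local_graph:
  assumes W: "open W" and reg: "boundary_regular_at (C_k_holder 1 \<alpha>) W x" and x: "x \<in> frontier W"
  obtains e r \<gamma> L where "local_graph W x e r \<gamma> L"
proof -
  obtain r e g where r: "r > 0" and e: "norm e = 1" and g: "C_k_holder 1 \<alpha> g (ball x r)"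
    and mem: "\<And>y. y \<in> ball x r \<Longrightarrow> y \<in> W \<longleftrightarrow> (y - x) \<bullet> e < g (y - ((y - x) \<bullet> e) *\<^sub>R e)"
    using reg unfolding boundary_regular_at_def by metis
  have ee: "e \<bullet> e = 1" using e by (simp add: norm_eq_1)
  define p where "p y = y - ((y - x) \<bullet> e) *\<^sub>R e" for y
  define \<gamma> where "\<gamma> y = g (p y)" for y
  have p_add: "p (y + s *\<^sub>R e) = p y" for y s
    using ee by (simp add: p_def inner_simps algebra_simps)
  have p_ball: "p y \<in> ball x r" if "y \<in> ball x r" for y
  proof -
    have "norm (p y - x) \<le> norm (y - x)"
      using norm_diff_proj_le[OF e, of "y - x"] by (simp add: p_def algebra_simps)
    then show ?thesis using that by (simp add: dist_norm norm_minus_commute)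
  qed
  have p_deriv: "(p has_derivative (\<lambda>v. v - (v \<bullet> e) *\<^sub>R e)) (at y)" for y
    unfolding p_def by (auto intro!: derivative_eq_intros)
  have p_cont: "continuous_on S p" for S unfolding p_def by (intro continuous_intros)
  have "Ck_ext 1 g (ball x r) (ball x r)" using g C_k_1_imp_Ck_ext unfolding C_k_holder_def by blast
  then obtain G where G: "continuous_on (ball x r) g"
    "\<And>y. y \<in> ball x r \<Longrightarrow> (g has_derivative (\<lambda>v. G y \<bullet> v)) (at y)"
    "\<And>i. Ck_ext 0 (\<lambda>y. G y $ i) (ball x r) (ball x r)"
    unfolding One_nat_def by (rule Ck_ext_SucE) blast
  have G_cont: "continuous_on (ball x r) G"
    using G(3) Ck_ext_imp_continuous_on continuous_on_vec_components by blast
  define \<Gamma> where "\<Gamma> y = G (p y) - (G (p y) \<bullet> e) *\<^sub>R e" for y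
  have pb: "p ` ball x r \<subseteq> ball x r" using p_ball by auto
  have \<Gamma>: "(\<gamma> has_derivative (\<lambda>v. \<Gamma> y \<bullet> v)) (at y)" if "y \<in> ball x r" for y
  proof -
    have "((\<lambda>y. g (p y)) has_derivative (\<lambda>v. G (p y) \<bullet> (v - (v \<bullet> e) *\<^sub>R e))) (at y)"
      by (rule has_derivative_compose[OF p_deriv G(2)[OF p_ball[OF that]]])
    then show ?thesis
      by (simp add: \<gamma>_def[abs_def] \<Gamma>_def inner_simps inner_commute[of _ e] mult.commute)
  qed
  have \<Gamma>_cont: "continuous_on (ball x r) \<Gamma>"
    unfolding \<Gamma>_def
    by (intro continuous_intros continuous_on_compose2[OF G_cont p_cont pb])
  have \<gamma>_cont: "continuous_on (ball x r) \<gamma>"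
    unfolding \<gamma>_def by (intro continuous_on_compose2[OF G(1) p_cont pb])
  have C1: "Ck_ext 1 \<gamma> (ball x r) (ball x r)"
    unfolding One_nat_def
    by (rule Ck_ext_SucI[OF \<gamma>_cont \<Gamma>]) (auto intro!: continuous_intros \<Gamma>_cont)
  have mem': "y \<in> W \<longleftrightarrow> (y - x) \<bullet> e < \<gamma> y" if "y \<in> ball x r" for y
    using mem[OF that] by (simp add: \<gamma>_def p_def)
  \<comment> \<open>A positive value would put the frontier point \<open>x\<close> into the open set
    \<open>W\<close>; with a negative one a neighbourhood of \<open>x\<close> would lie strictly
    above the graph and miss \<open>W\<close>.\<close>
  have "\<gamma> x = 0"
  proof (rule ccontr)
    assume "\<gamma> x \<noteq> 0"
    moreover have "x \<notin> W" using x W by (simp add: frontier_def interior_open)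
    then have "\<not> 0 < \<gamma> x" using mem'[of x] r by simp
    ultimately have "\<gamma> x < 0" by simp
    let ?U = "ball x r \<inter> (\<lambda>y. (y - x) \<bullet> e - \<gamma> y) -` {0<..}"
    have "open ?U"
      by (rule continuous_open_preimage) (auto intro!: continuous_intros \<gamma>_cont)
    moreover have "?U \<inter> W = {}" using mem' by auto
    ultimately have "?U \<inter> closure W = {}" by (simp add: open_Int_closure_eq_empty)
    moreover have "x \<in> ?U" using \<open>\<gamma> x < 0\<close> r by simp
    moreover have "x \<in> closure W" using x by (simp add: frontier_def)
    ultimately show False by blast
  qed
  \<comment> \<open>Halving the radius gives a compact ball inside the original one, on which the
    gradient is bounded.\<close>
  have sub: "cball x (r / 2) \<subseteq> ball x r" using r by auto
  obtain L where L: "L \<ge> 0"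
    "\<And>y z. y \<in> cball x (r/2) \<Longrightarrow> z \<in> cball x (r/2) \<Longrightarrow> \<bar>\<gamma> y - \<gamma> z\<bar> \<le> L * dist y z"
    using gradient_bound_imp_lipschitz[of x "r/2" \<gamma> \<Gamma>] \<Gamma> sub continuous_on_subset[OF \<Gamma>_cont sub] by blast
  have "local_graph W x e (r / 2) \<gamma> L"
  proof
    show "Ck_ext 1 \<gamma> (ball x (r / 2)) (ball x (r / 2))"
      using Ck_ext_subset[OF C1] sub ball_subset_cball by blast
    show "\<gamma> (y + s *\<^sub>R e) = \<gamma> y" for y s by (simp add: \<gamma>_def p_add)
    show "(y \<in> W) = ((y - x) \<bullet> e < \<gamma> y)" if "y \<in> ball x (r / 2)" for y
      using mem'[of y] that r by auto
  qed (use W r e L \<open>\<gamma> x = 0\<close> in auto)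
  then show ?thesis by (rule that)
qed

text \<open>If every component of \<Psi> - Id had zero gradient at \<open>x\<close>, the coefficient
  would be \<open>mat 1\<close>; so one component can serve as a defining function of the boundary
  near \<open>x\<close>.\<close>

lemma graph_Ck_ext_if_nontrivial_coeff:
  assumes open_W: "open W" and graph: "local_graph W x e r \<gamma> L" and x: "x \<in> frontier W"
    and \<Psi>: "\<And>i. Ck_ext 1 (\<lambda>x. \<Psi> x $ i) W (closure W)"
    and inj: "inj_on \<Psi> (closure W)" and id: "\<And>x. x \<in> frontier W \<Longrightarrow> \<Psi> x = x"
    and ne: "push_forward_coeff W \<Psi> x \<noteq> mat 1"
  obtains \<rho> where "\<rho> > 0" "\<rho> \<le> r" "\<And>k. (\<And>i. Ck_ext k (\<lambda>x. \<Psi> x $ i) W (closure W)) \<Longrightarrow>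
     Ck_ext k \<gamma> (ball x \<rho>) (ball x \<rho>)"
proof -
  interpret local_graph W x e r \<gamma> L by fact
  have xc: "x \<in> closure W" using x by (simp add: frontier_def)
  have f: "Ck_ext k (\<lambda>y. \<Psi> y $ i - y $ i) W (closure W)"
    if "\<And>i. Ck_ext k (\<lambda>x. \<Psi> x $ i) W (closure W)" for k i
    by (intro Ck_ext_diff Ck_ext_coord that)
  have "\<exists>F. continuous_on (closure W) (\<lambda>y. \<Psi> y $ i - y $ i) \<and> continuous_on (closure W) F \<and>
     (\<forall>y\<in>W. ((\<lambda>y. \<Psi> y $ i - y $ i) has_derivative (\<lambda>v. F y \<bullet> v)) (at y))" for i
  proof -
    obtain F where F: "continuous_on (closure W) (\<lambda>y. \<Psi> y $ i - y $ i)"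
      "\<And>y. y \<in> W \<Longrightarrow> ((\<lambda>y. \<Psi> y $ i - y $ i) has_derivative (\<lambda>v. F y \<bullet> v)) (at y)"
      "\<And>j. Ck_ext 0 (\<lambda>y. F y $ j) W (closure W)"
      using f[OF \<Psi>, of i] unfolding One_nat_def by (rule Ck_ext_SucE) blast
    have "continuous_on (closure W) F"
      using F(3) Ck_ext_imp_continuous_on continuous_on_vec_components by blast
    then show ?thesis using F by blast
  qed
  then obtain F where F: "\<And>i. continuous_on (closure W) (\<lambda>y. \<Psi> y $ i - y $ i)"
    "\<And>i y. y \<in> W \<Longrightarrow> ((\<lambda>y. \<Psi> y $ i - y $ i) has_derivative (\<lambda>v. F i y \<bullet> v)) (at y)"
    "\<And>i. continuous_on (closure W) (F i)" by metis
  have "\<exists>i. F i x \<noteq> 0"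
  proof (rule ccontr)
    assume "\<nexists>i. F i x \<noteq> 0"
    then have "((\<lambda>y. \<Psi> y $ i - y $ i) has_derivative (\<lambda>v. 0)) (at x within closure W)" for i
      using has_derivative_within_closure[OF F(1)[of i] F(2)[of _ i] F(3)[of i] xc] r_pos by simp
    then show False using push_forward_coeff_eq_mat_1[OF _ inj xc id[OF x]] ne by blast
  qed
  then obtain i where i: "F i x \<noteq> 0" by blast
  obtain \<rho> where "\<rho> > 0" "\<rho> \<le> r"
    "\<And>k. Ck_ext k (\<lambda>y. \<Psi> y $ i - y $ i) W (closure W) \<Longrightarrow> Ck_ext k \<gamma> (ball x \<rho>) (ball x \<rho>)"
    by (rule \<gamma>_Ck_ext_near[OF F(1)[of i] _ F(2)[of _ i] F(3)[of i] xc i]) (use id in auto)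
  then show ?thesis using that f by blast
qed

section \<open>Absolutely convergent power series\<close>

definition monomial :: "real^'n::finite \<Rightarrow> ('n \<Rightarrow> nat) \<Rightarrow> real" where
  "monomial z b = (\<Prod>i\<in>UNIV. (z $ i) ^ b i)"

definition total_degree :: "('n::finite \<Rightarrow> nat) \<Rightarrow> nat" where
  "total_degree b = sum b UNIV"

text \<open>\<open>u\<close> is given on the cube of half-width \<open>\<rho>\<close> by a power series whose coefficients have weighted
  \<open>l\<^sup>1\<close> norm at most \<open>M\<close>, so that such functions form a Banach algebra of analytic functions.\<close>

definition ps_bound :: "real \<Rightarrow> real \<Rightarrow> (real^'n::finite \<Rightarrow> real) \<Rightarrow> bool" where
  "ps_bound \<rho> M u \<longleftrightarrow> (\<exists>a. (\<exists>N\<le>M. ((\<lambda>b. \<bar>a b\<bar> * \<rho> ^ total_degree b) has_sum N) UNIV) \<and>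
     (\<forall>z. (\<forall>i. \<bar>z $ i\<bar> \<le> \<rho>) \<longrightarrow> ((\<lambda>b. a b * monomial z b) has_sum u z) UNIV))"

lemma ps_boundI:
  assumes "((\<lambda>b. \<bar>a b\<bar> * \<rho> ^ total_degree b) has_sum N) UNIV" "N \<le> M"
    "\<And>z. (\<And>i. \<bar>z $ i\<bar> \<le> \<rho>) \<Longrightarrow> ((\<lambda>b. a b * monomial z b) has_sum u z) UNIV"
  shows "ps_bound \<rho> M u"
  using assms unfolding ps_bound_def by blast

lemma ps_boundE:
  assumes "ps_bound \<rho> M u"
  obtains a N where "((\<lambda>b. \<bar>a b\<bar> * \<rho> ^ total_degree b) has_sum N) UNIV" "N \<le> M"
    "\<And>z. (\<And>i. \<bar>z $ i\<bar> \<le> \<rho>) \<Longrightarrow> ((\<lambda>b. a b * monomial z b) has_sum u z) UNIV"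
  using assms unfolding ps_bound_def by blast

lemma ps_bound_mono: "ps_bound \<rho> M u \<Longrightarrow> M \<le> M' \<Longrightarrow> ps_bound \<rho> M' u"
  unfolding ps_bound_def by (meson order_trans)

lemma abs_monomial_le:
  assumes "\<And>i. \<bar>z $ i\<bar> \<le> \<rho>"
  shows "\<bar>monomial z b\<bar> \<le> \<rho> ^ total_degree b"
proof -
  have "\<bar>monomial z b\<bar> = (\<Prod>i\<in>UNIV. \<bar>z $ i\<bar> ^ b i)"
    by (simp add: monomial_def abs_prod power_abs)
  also have "\<dots> \<le> (\<Prod>i\<in>UNIV. \<rho> ^ b i)"
    by (intro prod_mono) (simp add: power_mono assms)
  finally show ?thesis by (simp add: total_degree_def power_sum)
qed

lemma ps_bound_abs_le:
  assumes "ps_bound \<rho> M u" "\<And>i. \<bar>z $ i\<bar> \<le> \<rho>"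
  shows "\<bar>u z\<bar> \<le> M"
proof -
  obtain a N where a: "((\<lambda>b. \<bar>a b\<bar> * \<rho> ^ total_degree b) has_sum N) UNIV" "N \<le> M"
    "((\<lambda>b. a b * monomial z b) has_sum u z) UNIV"
    using ps_boundE[OF assms(1)] assms(2) by metis
  have le: "\<bar>a b * monomial z b\<bar> \<le> \<bar>a b\<bar> * \<rho> ^ total_degree b" for b
    unfolding abs_mult by (intro mult_left_mono abs_monomial_le assms(2)) auto
  have "u z \<le> N"
    by (rule has_sum_mono[OF a(3,1)]) (use le abs_le_D1 in blast)
  moreover have "- u z \<le> N"
    by (rule has_sum_mono[OF _ a(1), where f = "\<lambda>b. - (a b * monomial z b)"])
      (use le abs_le_D2 a(3) in \<open>auto simp: has_sum_uminus\<close>)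
  ultimately show ?thesis using a(2) by linarith
qed

lemma ps_bound_nonneg: "ps_bound \<rho> M u \<Longrightarrow> 0 \<le> \<rho> \<Longrightarrow> 0 \<le> M"
  using ps_bound_abs_le[of \<rho> M u 0] by force

text \<open>Completeness of the norm in summed form: the weighted double family of coefficients is
  absolutely summable, so the sums over \<open>j\<close> and over multi-indices may be exchanged.
  Sums, products, substitutions and the limit of the iteration all rest on it.\<close>

lemma ps_bound_has_sum:
  fixes u :: "'j \<Rightarrow> real^'n::finite \<Rightarrow> real"
  assumes \<rho>: "\<rho> > 0" and u: "\<And>j. ps_bound \<rho> (M j) (u j)" and M: "(M has_sum S) UNIV"
    and v: "\<And>z. (\<And>i. \<bar>z $ i\<bar> \<le> \<rho>) \<Longrightarrow> ((\<lambda>j. u j z) has_sum v z) UNIV"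
  shows "ps_bound \<rho> S v"
proof -
  have "\<forall>j. \<exists>p. ((\<lambda>b. \<bar>fst p b\<bar> * \<rho> ^ total_degree b) has_sum snd p) UNIV \<and> snd p \<le> M j \<and>
    (\<forall>z. (\<forall>i. \<bar>z $ i\<bar> \<le> \<rho>) \<longrightarrow> ((\<lambda>b. fst p b * monomial z b) has_sum u j z) UNIV)"
    using u unfolding ps_bound_def split_paired_Ex fst_conv snd_conv by blast
  from choice[OF this] obtain p where p: "\<forall>j. ((\<lambda>b. \<bar>fst (p j) b\<bar> * \<rho> ^ total_degree b) has_sum snd (p j)) UNIV \<and>
    snd (p j) \<le> M j \<and>
    (\<forall>z. (\<forall>i. \<bar>z $ i\<bar> \<le> \<rho>) \<longrightarrow> ((\<lambda>b. fst (p j) b * monomial z b) has_sum u j z) UNIV)" ..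
  define a N where "a j = fst (p j)" and "N j = snd (p j)" for j
  have a: "((\<lambda>b. \<bar>a j b\<bar> * \<rho> ^ total_degree b) has_sum N j) UNIV" and N: "N j \<le> M j" for j
    using p by (auto simp: a_def N_def)
  have s: "((\<lambda>b. a j b * monomial z b) has_sum u j z) UNIV" if "\<And>i. \<bar>z $ i\<bar> \<le> \<rho>" for j z
    using p that by (auto simp: a_def)
  have N0: "N j \<ge> 0" for j by (rule has_sum_nonneg[OF a]) (use \<rho> in auto)
  have "M summable_on UNIV" using M by (auto simp: summable_on_def)
  then have "N summable_on UNIV"
    by (rule summable_on_comparison_test) (use N N0 in auto)
  then obtain T where T: "(N has_sum T) UNIV" by (auto simp: summable_on_def)
  have "T \<le> S" by (rule has_sum_mono[OF T M]) (use N in auto)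
  define f where "f = (\<lambda>(j, b). \<bar>a j b\<bar> * \<rho> ^ total_degree b)"
  have f: "f summable_on UNIV \<times> UNIV"
    by (rule summable_on_SigmaI[where g = N])
      (use a \<rho> \<open>N summable_on UNIV\<close> in \<open>auto simp: f_def\<close>)
  have fT: "(f has_sum T) (UNIV \<times> UNIV)"
    by (rule has_sum_SigmaI[OF _ T f]) (use a in \<open>auto simp: f_def\<close>)
  then have fT': "((\<lambda>(b, j). f (j, b)) has_sum T) (UNIV \<times> UNIV)" by (subst (asm) has_sum_swap)
  have abs_s: "(\<lambda>j. \<bar>a j b\<bar>) summable_on UNIV" for b
  proof -
    have "(\<lambda>j. f (j, b)) summable_on UNIV"
      using summable_on_SigmaD1[of "\<lambda>b j. f (j, b)" UNIV "\<lambda>_. UNIV" b] fT' by (auto simp: summable_on_def)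
    then have "(\<lambda>j. f (j, b) * inverse (\<rho> ^ total_degree b)) summable_on UNIV"
      by (rule summable_on_cmult_left)
    then show ?thesis using \<rho> by (simp add: f_def mult.assoc)
  qed
  have a_s: "(\<lambda>j. a j b) summable_on UNIV" for b
    using abs_s[of b] summable_on_iff_abs_summable_on_real[of "\<lambda>j. a j b" UNIV] by simp
  \<comment> \<open>Coefficient of the limit. Weighted absolute summability over pairs gives
    absolute summability over \<open>j\<close> for each fixed multi-index, the weight being a
    positive constant there.\<close>
  define c where "c b = infsum (\<lambda>j. a j b) UNIV" for b
  have c: "((\<lambda>j. a j b) has_sum c b) UNIV" for b
    unfolding c_def using a_s by simp
  define d where "d b = infsum (\<lambda>j. \<bar>a j b\<bar>) UNIV" for b
  have d: "((\<lambda>j. \<bar>a j b\<bar>) has_sum d b) UNIV" for b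
    unfolding d_def using abs_s by simp
  have dT: "((\<lambda>b. d b * \<rho> ^ total_degree b) has_sum T) UNIV"
    by (rule has_sum_SigmaD[OF fT']) (auto simp: f_def intro!: has_sum_cmult_left d)
  have cd: "\<bar>c b\<bar> \<le> d b" for b
    using norm_has_sum_bound[OF _ c[of b], of "d b"] d[of b] by simp
  have cd': "\<bar>c b\<bar> * \<rho> ^ total_degree b \<le> d b * \<rho> ^ total_degree b" for b
    using cd \<rho> by (intro mult_right_mono) auto
  have "(\<lambda>b. d b * \<rho> ^ total_degree b) summable_on UNIV" using dT by (auto simp: summable_on_def)
  then have "(\<lambda>b. \<bar>c b\<bar> * \<rho> ^ total_degree b) summable_on UNIV"
    by (rule summable_on_comparison_test) (use cd' \<rho> in auto)
  then obtain N' where N': "((\<lambda>b. \<bar>c b\<bar> * \<rho> ^ total_degree b) has_sum N') UNIV"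
    by (auto simp: summable_on_def)
  show ?thesis
  proof (rule ps_boundI[OF N'])
    show "N' \<le> S" using has_sum_mono[OF N' dT cd'] \<open>T \<le> S\<close> by simp
    fix z :: "real^'n" assume z: "\<And>i. \<bar>z $ i\<bar> \<le> \<rho>"
    define g where "g = (\<lambda>(j, b). a j b * monomial z b)"
    have "norm (g p) \<le> f p" for p
      unfolding g_def f_def by (cases p) (auto simp: abs_mult intro!: mult_left_mono abs_monomial_le z)
    then have "(\<lambda>p. norm (g p)) summable_on UNIV \<times> UNIV"
      by (intro Infinite_Sum.abs_summable_on_comparison_test'[OF f])
    then have g: "g summable_on UNIV \<times> UNIV"
      using summable_on_iff_abs_summable_on_real by blast
    have "(g has_sum v z) (UNIV \<times> UNIV)"
      by (rule has_sum_SigmaI[OF _ v[OF z] g]) (use s z in \<open>auto simp: g_def\<close>)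
    then have "((\<lambda>(b, j). g (j, b)) has_sum v z) (UNIV \<times> UNIV)" by (subst (asm) has_sum_swap)
    then show "((\<lambda>b. c b * monomial z b) has_sum v z) UNIV"
      by (rule has_sum_SigmaD) (auto simp: g_def intro!: has_sum_cmult_left c)
  qed
qed

section \<open>Algebraic operations on power series\<close>

lemma ps_bound_monomial:
  assumes "\<rho> \<ge> 0"
  shows "ps_bound \<rho> (\<bar>c\<bar> * \<rho> ^ total_degree b) (\<lambda>z. c * monomial z b)"
proof (rule ps_boundI[where a = "\<lambda>b'. if b' = b then c else 0", OF _ order_refl])
  show "((\<lambda>b'. \<bar>if b' = b then c else 0\<bar> * \<rho> ^ total_degree b') has_sum \<bar>c\<bar> * \<rho> ^ total_degree b) UNIV"
    by (rule has_sum_finite_neutralI[of "{b}"]) auto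
  show "((\<lambda>b'. (if b' = b then c else 0) * monomial z b') has_sum c * monomial z b) UNIV" for z
    by (rule has_sum_finite_neutralI[of "{b}"]) auto
qed

lemma ps_bound_const: "\<rho> \<ge> 0 \<Longrightarrow> ps_bound \<rho> \<bar>c\<bar> (\<lambda>_. c)"
  using ps_bound_monomial[of \<rho> c "\<lambda>_. 0"] by (simp add: monomial_def total_degree_def)

definition unit_index :: "'n \<Rightarrow> 'n \<Rightarrow> nat" where
  "unit_index i = (\<lambda>j. if j = i then 1 else 0)"

lemma monomial_unit_index: "monomial z (unit_index i) = z $ i"
proof -
  have "monomial z (unit_index i) = (\<Prod>j\<in>UNIV. if j = i then z $ j else 1)"
    unfolding monomial_def unit_index_def by (intro prod.cong) auto
  then show ?thesis by simp
qed

lemma total_degree_unit_index: "total_degree (unit_index i) = 1"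
  by (simp add: total_degree_def unit_index_def)

lemma ps_bound_coord: "\<rho> \<ge> 0 \<Longrightarrow> ps_bound \<rho> \<rho> (\<lambda>z. z $ i)"
  using ps_bound_monomial[of \<rho> 1 "unit_index i"]
  by (simp add: monomial_unit_index total_degree_unit_index)

lemma ps_bound_add:
  assumes "\<rho> > 0" "ps_bound \<rho> M u" "ps_bound \<rho> N v"
  shows "ps_bound \<rho> (M + N) (\<lambda>z. u z + v z)"
\<comment> \<open>The two summands are treated as a family indexed by the booleans.\<close>
proof (rule ps_bound_has_sum[where u = "\<lambda>j. if j then u else v" and M = "\<lambda>j. if j then M else N"])
  show "ps_bound \<rho> (if j then M else N) (if j then u else v)" for j using assms by simp
qed (use assms in \<open>auto intro!: has_sum_finiteI simp: UNIV_bool\<close>)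

lemma monomial_add: "monomial z (\<lambda>i. b i + b' i) = monomial z b * monomial z b'"
  by (simp add: monomial_def power_add prod.distrib)

lemma total_degree_add: "total_degree (\<lambda>i. b i + b' i) = total_degree b + total_degree b'"
  by (simp add: total_degree_def sum.distrib)

lemma has_sum_product_nonneg:
  fixes f :: "'a \<Rightarrow> real" and g :: "'b \<Rightarrow> real"
  assumes "(f has_sum A) UNIV" "(g has_sum B) UNIV" "\<And>x. f x \<ge> 0" "\<And>y. g y \<ge> 0"
  shows "((\<lambda>(x, y). f x * g y) has_sum A * B) (UNIV \<times> UNIV)"
proof -
  have i: "((\<lambda>y. case (x, y) of (x, y) \<Rightarrow> f x * g y) has_sum f x * B) UNIV" for x
    using has_sum_cmult_right[OF assms(2)] by simp
  have o: "((\<lambda>x. f x * B) has_sum A * B) UNIV" by (rule has_sum_cmult_left[OF assms(1)])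
  show ?thesis
  proof (rule has_sum_SigmaI[OF i o])
    show "(\<lambda>(x, y). f x * g y) summable_on UNIV \<times> UNIV"
      by (rule summable_on_SigmaI[OF i]) (use o assms in \<open>auto simp: summable_on_def\<close>)
  qed
qed

text \<open>No Cauchy product is formed: the product is a sum of single monomials over pairs of
  multi-indices, whose norms factor, and \<open>ps_bound_has_sum\<close> collects equal
  exponents.\<close>

lemma ps_bound_mult:
  fixes u v :: "real^'n::finite \<Rightarrow> real"
  assumes \<rho>: "\<rho> > 0" and u: "ps_bound \<rho> M u" and v: "ps_bound \<rho> N v"
  shows "ps_bound \<rho> (M * N) (\<lambda>z. u z * v z)"
proof -
  obtain a M' where a: "((\<lambda>b. \<bar>a b\<bar> * \<rho> ^ total_degree b) has_sum M') UNIV" "M' \<le> M"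
    "\<And>z. (\<And>i. \<bar>z $ i\<bar> \<le> \<rho>) \<Longrightarrow> ((\<lambda>b. a b * monomial z b) has_sum u z) UNIV"
    using u by (rule ps_boundE) blast
  obtain c N' where c: "((\<lambda>b. \<bar>c b\<bar> * \<rho> ^ total_degree b) has_sum N') UNIV" "N' \<le> N"
    "\<And>z. (\<And>i. \<bar>z $ i\<bar> \<le> \<rho>) \<Longrightarrow> ((\<lambda>b. c b * monomial z b) has_sum v z) UNIV"
    using v by (rule ps_boundE) blast
  have pos: "N' \<ge> 0" "M \<ge> 0"
    using has_sum_nonneg[OF c(1)] ps_bound_nonneg[OF u] \<rho> by auto
  define A where "A = (\<lambda>(b, b'). (\<bar>a b\<bar> * \<rho> ^ total_degree b) * (\<bar>c b'\<bar> * \<rho> ^ total_degree b'))"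
  have A: "(A has_sum M' * N') (UNIV \<times> UNIV)"
    unfolding A_def by (rule has_sum_product_nonneg[OF a(1) c(1)]) (use \<rho> in auto)
  have "ps_bound \<rho> (M' * N') (\<lambda>z. u z * v z)"
  proof (rule ps_bound_has_sum[OF \<rho>])
    show "(A has_sum M' * N') UNIV" using A by simp
    show "ps_bound \<rho> (A p) (\<lambda>z. (a (fst p) * c (snd p)) * monomial z (\<lambda>i. fst p i + snd p i))" for p
      using ps_bound_monomial[of \<rho> "a (fst p) * c (snd p)" "\<lambda>i. fst p i + snd p i"] \<rho>
      by (simp add: A_def case_prod_beta total_degree_add power_add abs_mult mult_ac)
    fix z :: "real^'n" assume z: "\<And>i. \<bar>z $ i\<bar> \<le> \<rho>"
    let ?g = "\<lambda>p. a (fst p) * c (snd p) * monomial z (\<lambda>i. fst p i + snd p i)"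
    have "norm (?g p) \<le> A p" for p
    proof -
      have "norm (?g p) = (\<bar>a (fst p)\<bar> * \<bar>monomial z (fst p)\<bar>) * (\<bar>c (snd p)\<bar> * \<bar>monomial z (snd p)\<bar>)"
        by (simp add: monomial_add abs_mult)
      also have "\<dots> \<le> A p"
        unfolding A_def case_prod_beta using \<rho>
        by (intro mult_mono mult_left_mono abs_monomial_le z) auto
      finally show ?thesis .
    qed
    moreover have "A summable_on UNIV \<times> UNIV" using A by (auto simp: summable_on_def)
    ultimately have "(\<lambda>p. norm (?g p)) summable_on UNIV \<times> UNIV"
      using Infinite_Sum.abs_summable_on_comparison_test'[of A _ ?g] by blast
    then have g: "?g summable_on UNIV \<times> UNIV"
      using summable_on_iff_abs_summable_on_real by blast
    have "(?g has_sum u z * v z) (UNIV \<times> UNIV)"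
    proof (rule has_sum_SigmaI[OF _ has_sum_cmult_left[OF a(3)[OF z]] g])
      fix b
      have "((\<lambda>b'. (a b * monomial z b) * (c b' * monomial z b')) has_sum (a b * monomial z b) * v z) UNIV"
        by (rule has_sum_cmult_right[OF c(3)[OF z]])
      then show "((\<lambda>b'. ?g (b, b')) has_sum (a b * monomial z b) * v z) UNIV"
        by (simp add: monomial_add mult_ac)
    qed
    then show "(?g has_sum u z * v z) UNIV" by simp
  qed
  moreover have "M' * N' \<le> M * N" using a(2) c(2) pos by (intro mult_mono) auto
  ultimately show ?thesis by (rule ps_bound_mono)
qed

lemma ps_bound_cmult:
  assumes "\<rho> > 0" "ps_bound \<rho> M u"
  shows "ps_bound \<rho> (\<bar>c\<bar> * M) (\<lambda>z. c * u z)"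
  using ps_bound_mult[OF assms(1) ps_bound_const assms(2)] assms(1) by simp

lemma ps_bound_diff:
  assumes "\<rho> > 0" "ps_bound \<rho> M u" "ps_bound \<rho> N v"
  shows "ps_bound \<rho> (M + N) (\<lambda>z. u z - v z)"
  using ps_bound_add[OF assms(1,2) ps_bound_cmult[OF assms(1,3), of "-1"]] by simp

lemma ps_bound_sum:
  assumes "\<rho> > 0" "\<And>i. i \<in> I \<Longrightarrow> ps_bound \<rho> (M i) (u i)"
  shows "ps_bound \<rho> (\<Sum>i\<in>I. M i) (\<lambda>z. \<Sum>i\<in>I. u i z)"
  using assms(2)
proof (induction I rule: infinite_finite_induct)
  case (insert i I)
  have "ps_bound \<rho> (M i + sum M I) (\<lambda>z. u i z + (\<Sum>i\<in>I. u i z))"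
    by (rule ps_bound_add[OF assms(1)]) (use insert in auto)
  then show ?case using insert.hyps by simp
qed (use assms(1) ps_bound_const[of \<rho> 0] in auto)

lemma ps_bound_power:
  assumes "\<rho> > 0" "ps_bound \<rho> M u"
  shows "ps_bound \<rho> (M ^ n) (\<lambda>z. u z ^ n)"
  by (induction n) (use assms ps_bound_const[of \<rho> 1] in \<open>auto intro: ps_bound_mult\<close>)

lemma ps_bound_monomial_comp:
  fixes w :: "real^'n::finite \<Rightarrow> real^'m::finite"
  assumes "\<rho> > 0" "\<And>i. ps_bound \<rho> s (\<lambda>z. w z $ i)"
  shows "ps_bound \<rho> (s ^ total_degree b) (\<lambda>z. monomial (w z) b)"
proof -
  have "ps_bound \<rho> (\<Prod>i\<in>I. s ^ b i) (\<lambda>z. \<Prod>i\<in>I. (w z $ i) ^ b i)" if "finite I" for I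
    using that
  proof induction
    case (insert i I)
    then show ?case using ps_bound_mult[OF assms(1) ps_bound_power[OF assms]] by simp
  qed (use assms(1) ps_bound_const[of \<rho> 1] in auto)
  from this[of UNIV] show ?thesis by (simp add: monomial_def total_degree_def power_sum)
qed

text \<open>Substituting components of norm at most \<open>s\<close> turns a monomial of degree n
  into a function of norm at most s^n, which is its weight in the norm of \<open>u\<close>.\<close>

lemma ps_bound_comp:
  fixes w :: "real^'n::finite \<Rightarrow> real^'m::finite"
  assumes u: "ps_bound s M u" and \<rho>: "\<rho> > 0" and w: "\<And>i. ps_bound \<rho> s (\<lambda>z. w z $ i)"
  shows "ps_bound \<rho> M (\<lambda>z. u (w z))"
proof -
  obtain a N where a: "((\<lambda>b. \<bar>a b\<bar> * s ^ total_degree b) has_sum N) UNIV" "N \<le> M"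
    "\<And>z. (\<And>i. \<bar>z $ i\<bar> \<le> s) \<Longrightarrow> ((\<lambda>b. a b * monomial z b) has_sum u z) UNIV"
    using u by (rule ps_boundE) blast
  have "ps_bound \<rho> N (\<lambda>z. u (w z))"
  proof (rule ps_bound_has_sum[OF \<rho> _ a(1)])
    show "ps_bound \<rho> (\<bar>a b\<bar> * s ^ total_degree b) (\<lambda>z. a b * monomial (w z) b)" for b
      by (rule ps_bound_cmult[OF \<rho> ps_bound_monomial_comp[OF \<rho> w]])
    show "((\<lambda>b. a b * monomial (w z) b) has_sum u (w z)) UNIV" if "\<And>i. \<bar>z $ i\<bar> \<le> \<rho>" for z
      by (rule a(3)) (rule ps_bound_abs_le[OF w that])
  qed
  then show ?thesis using a(2) by (rule ps_bound_mono)
qed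

text \<open>The bound \<open>n s\<^bsup>n-1\<^esup> \<delta>\<close> on the increment of a degree \<open>n\<close> monomial propagates through products;
  at \<open>n = 0\<close> it is \<open>0\<close> despite the truncated exponent.\<close>

lemma ps_bound_mult_diff:
  assumes \<rho>: "\<rho> > 0" and s: "s \<ge> 0"
    and "ps_bound \<rho> (s ^ n) u" "ps_bound \<rho> (s ^ m) v'"
    and du: "ps_bound \<rho> (real n * s ^ (n - 1) * \<delta>) (\<lambda>z. u z - u' z)"
    and dv: "ps_bound \<rho> (real m * s ^ (m - 1) * \<delta>) (\<lambda>z. v z - v' z)"
  shows "ps_bound \<rho> (real (n + m) * s ^ (n + m - 1) * \<delta>) (\<lambda>z. u z * v z - u' z * v' z)"
proof -
  have "ps_bound \<rho> (s ^ n * (real m * s ^ (m - 1) * \<delta>) + real n * s ^ (n - 1) * \<delta> * s ^ m)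
      (\<lambda>z. u z * (v z - v' z) + (u z - u' z) * v' z)"
    by (intro ps_bound_add ps_bound_mult assms)
  moreover have "s ^ n * (real m * s ^ (m - 1) * \<delta>) = real m * s ^ (n + m - 1) * \<delta>"
    by (cases m) (auto simp: power_add)
  moreover have "real n * s ^ (n - 1) * \<delta> * s ^ m = real n * s ^ (n + m - 1) * \<delta>"
    by (cases n) (auto simp: power_add)
  moreover have "(\<lambda>z. u z * (v z - v' z) + (u z - u' z) * v' z) = (\<lambda>z. u z * v z - u' z * v' z)"
    by (simp add: algebra_simps)
  ultimately show ?thesis by (simp only: of_nat_add distrib_left distrib_right add.commute)
qed

text \<open>The product rule for increments is iterated over the powers of one coordinate and then
  over the coordinates; the total degree counts the factors.\<close>

lemma ps_bound_monomial_diff: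
  fixes w w' :: "real^'n::finite \<Rightarrow> real^'m::finite"
  assumes \<rho>: "\<rho> > 0" and s: "s \<ge> 0"
    and w: "\<And>i. ps_bound \<rho> s (\<lambda>z. w z $ i)" and w': "\<And>i. ps_bound \<rho> s (\<lambda>z. w' z $ i)"
    and d: "\<And>i. ps_bound \<rho> \<delta> (\<lambda>z. w z $ i - w' z $ i)"
  shows "ps_bound \<rho> (real (total_degree b) * s ^ (total_degree b - 1) * \<delta>)
    (\<lambda>z. monomial (w z) b - monomial (w' z) b)"
proof -
  have zero: "ps_bound \<rho> 0 (\<lambda>_. 0)" and one: "ps_bound \<rho> 1 (\<lambda>_. 1)"
    using ps_bound_const[of \<rho> 0] ps_bound_const[of \<rho> 1] \<rho> by auto
  have p: "ps_bound \<rho> (real n * s ^ (n - 1) * \<delta>) (\<lambda>z. (w z $ i) ^ n - (w' z $ i) ^ n)" for i n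
  proof (induction n)
    case (Suc n)
    have "ps_bound \<rho> (real (1 + n) * s ^ (1 + n - 1) * \<delta>)
        (\<lambda>z. w z $ i * (w z $ i) ^ n - w' z $ i * (w' z $ i) ^ n)"
      by (rule ps_bound_mult_diff[OF \<rho> s]) (use w d Suc ps_bound_power[OF \<rho> w'] in auto)
    then show ?case by simp
  qed (use zero in simp)
  have prod: "ps_bound \<rho> (s ^ sum b I) (\<lambda>z. \<Prod>i\<in>I. (v z $ i) ^ b i)"
    if "\<And>i. ps_bound \<rho> s (\<lambda>z. v z $ i)" "finite I" for I and v :: "real^'n \<Rightarrow> real^'m"
    using that(2)
  proof induction
    case (insert i I)
    then show ?case
      using ps_bound_mult[OF \<rho> ps_bound_power[OF \<rho> that(1)[of i], of "b i"]] by (simp add: power_add)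
  qed (use one in simp)
  have "ps_bound \<rho> (real (sum b I) * s ^ (sum b I - 1) * \<delta>)
      (\<lambda>z. (\<Prod>i\<in>I. (w z $ i) ^ b i) - (\<Prod>i\<in>I. (w' z $ i) ^ b i))" if "finite I" for I
    using that
  proof induction
    case (insert i I)
    then show ?case
      using ps_bound_mult_diff[OF \<rho> s ps_bound_power[OF \<rho> w[of i], of "b i"] prod[of w' I] p[of "b i" i] insert.IH] w'
      by simp
  qed (use zero in simp)
  from this[of UNIV] show ?thesis by (simp add: monomial_def total_degree_def)
qed

section \<open>Linearization of a power series\<close>

lemma inj_unit_index: "inj unit_index"
  unfolding inj_def unit_index_def by (metis zero_neq_one)

lemma total_degree_eq_1_iff: "total_degree b = 1 \<longleftrightarrow> b \<in> range unit_index"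
proof
  assume "total_degree b = 1"
  then obtain i where "b i = 1" "\<And>j. j \<noteq> i \<Longrightarrow> b j = 0"
    unfolding total_degree_def by (metis UNIV_I finite sum_eq_1_iff)
  then have "b = unit_index i" by (auto simp: unit_index_def)
  then show "b \<in> range unit_index" by simp
qed (use total_degree_unit_index in auto)

lemma has_sum_diff_real:
  fixes f g :: "'a \<Rightarrow> real"
  assumes "(f has_sum a) A" "(g has_sum b) A"
  shows "((\<lambda>x. f x - g x) has_sum (a - b)) A"
  using has_sum_add[OF assms(1), of "\<lambda>x. - g x" "- b"] assms(2) by (simp add: has_sum_uminus)

text \<open>The increment of the part of \<open>u\<close> of order at least two. The constant comes from
  \<open>n s\<^bsup>n-1\<^esup> \<le> 2 s s0\<^bsup>n-2\<^esup>\<close> for \<open>n \<ge> 2\<close> and \<open>2 s \<le> s0\<close>.\<close>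

lemma ps_bound_linearization:
  fixes u :: "real^'n::finite \<Rightarrow> real"
  assumes u: "ps_bound s0 M u" and s0: "s0 > 0"
  obtains q C where "C \<ge> 0"
    "\<And>\<rho> s \<delta> (w :: real^'n \<Rightarrow> real^'n) w'. \<lbrakk>\<rho> > 0; 0 \<le> s; s \<le> s0 / 2; 0 \<le> \<delta>;
      \<And>i. ps_bound \<rho> s (\<lambda>z. w z $ i); \<And>i. ps_bound \<rho> s (\<lambda>z. w' z $ i);
      \<And>i. ps_bound \<rho> \<delta> (\<lambda>z. w z $ i - w' z $ i)\<rbrakk>
      \<Longrightarrow> ps_bound \<rho> (C * s * \<delta>) (\<lambda>z. (u (w z) - q \<bullet> w z) - (u (w' z) - q \<bullet> w' z))"
proof -
  obtain a N where a: "((\<lambda>b. \<bar>a b\<bar> * s0 ^ total_degree b) has_sum N) UNIV" "N \<le> M"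
    "\<And>z. (\<And>i. \<bar>z $ i\<bar> \<le> s0) \<Longrightarrow> ((\<lambda>b. a b * monomial z b) has_sum u z) UNIV"
    using u by (rule ps_boundE) blast
  define q where "q = (\<chi> i. a (unit_index i))"
  \<comment> \<open>Only degree one is removed: the constant term cancels in the differences
    estimated below.\<close>
  define a' where "a' b = (if total_degree b = 1 then 0 else a b)" for b
  have a': "((\<lambda>b. a' b * monomial z b) has_sum (u z - q \<bullet> z)) UNIV" if z: "\<And>i. \<bar>z $ i\<bar> \<le> s0" for z
  proof -
    have "((\<lambda>b. if total_degree b = 1 then a b * monomial z b else 0) has_sum q \<bullet> z) UNIV"
    proof (rule has_sum_finite_neutralI[of "range unit_index"])
      have "(\<Sum>b\<in>range unit_index. if total_degree b = 1 then a b * monomial z b else 0)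
        = (\<Sum>i\<in>UNIV. a (unit_index i) * z $ i)"
        by (simp add: sum.reindex[OF inj_unit_index] monomial_unit_index total_degree_unit_index)
      then show "q \<bullet> z = (\<Sum>b\<in>range unit_index. if total_degree b = 1 then a b * monomial z b else 0)"
        by (simp add: q_def inner_vec_def)
      show "(if total_degree b = 1 then a b * monomial z b else 0) = 0" if "b \<in> UNIV - range unit_index" for b
        using that total_degree_eq_1_iff by auto
    qed auto
    from has_sum_diff_real[OF a(3)[OF z] this]
    show ?thesis by (rule has_sum_cong[THEN iffD1, rotated]) (auto simp: a'_def)
  qed
  define C where "C = 2 * N / s0\<^sup>2"
  have N0: "N \<ge> 0" by (rule has_sum_nonneg[OF a(1)]) (use s0 in auto)
  then have C0: "C \<ge> 0" by (simp add: C_def)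
  show ?thesis
  proof (rule that[OF C0])
    fix \<rho> s \<delta> :: real and w w' :: "real^'n \<Rightarrow> real^'n"
    assume \<rho>: "\<rho> > 0" and s: "0 \<le> s" "s \<le> s0 / 2" and \<delta>: "0 \<le> \<delta>"
      and w: "\<And>i. ps_bound \<rho> s (\<lambda>z. w z $ i)" "\<And>i. ps_bound \<rho> s (\<lambda>z. w' z $ i)"
      and dw: "\<And>i. ps_bound \<rho> \<delta> (\<lambda>z. w z $ i - w' z $ i)"
    have ss0: "s \<le> s0" using s s0 by linarith
    show "ps_bound \<rho> (C * s * \<delta>) (\<lambda>z. (u (w z) - q \<bullet> w z) - (u (w' z) - q \<bullet> w' z))"
    proof (rule ps_bound_has_sum[OF \<rho>, where u = "\<lambda>b z. a' b * (monomial (w z) b - monomial (w' z) b)"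
          and M = "\<lambda>b. \<bar>a b\<bar> * s0 ^ total_degree b * (2 / s0\<^sup>2 * s * \<delta>)"])
      have "((\<lambda>b. \<bar>a b\<bar> * s0 ^ total_degree b * (2 / s0\<^sup>2 * s * \<delta>)) has_sum (N * (2 / s0\<^sup>2 * s * \<delta>))) UNIV"
        by (rule has_sum_cmult_left[OF a(1)])
      then show "((\<lambda>b. \<bar>a b\<bar> * s0 ^ total_degree b * (2 / s0\<^sup>2 * s * \<delta>)) has_sum (C * s * \<delta>)) UNIV"
        by (simp add: C_def mult_ac)
      fix z :: "real^'n" assume z: "\<And>i. \<bar>z $ i\<bar> \<le> \<rho>"
      have "\<bar>w z $ i\<bar> \<le> s0" "\<bar>w' z $ i\<bar> \<le> s0" for i
        using ps_bound_abs_le[OF w(1) z] ps_bound_abs_le[OF w(2) z] ss0 order_trans by blast+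
      from has_sum_diff_real[OF a'[OF this(1)] a'[OF this(2)]]
      show "((\<lambda>b. a' b * (monomial (w z) b - monomial (w' z) b)) has_sum
          (u (w z) - q \<bullet> w z) - (u (w' z) - q \<bullet> w' z)) UNIV"
        by (simp add: right_diff_distrib)
    next
      fix b :: "'n \<Rightarrow> nat"
      let ?n = "total_degree b"
      have P: "ps_bound \<rho> (\<bar>a' b\<bar> * (real ?n * s ^ (?n - 1) * \<delta>))
          (\<lambda>z. a' b * (monomial (w z) b - monomial (w' z) b))"
        by (intro ps_bound_cmult \<rho> ps_bound_monomial_diff s(1) w dw)
      have "\<bar>a' b\<bar> * (real ?n * s ^ (?n - 1) * \<delta>) \<le> \<bar>a b\<bar> * s0 ^ ?n * (2 / s0\<^sup>2 * s * \<delta>)"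
      proof (cases "?n \<ge> 2")
        case True
        then obtain k where k: "?n = k + 2" by (metis add.commute le_Suc_ex)
        \<comment> \<open>This is n <= 2^(n-1) for n = k + 2; the powers of 2 are absorbed by
          \<open>(2 * s) ^ k \<le> s0 ^ k\<close>.\<close>
        have "real (k + 2) \<le> 2 * 2 ^ k"
          by (induction k) auto
        then have "real (k + 2) * s ^ k \<le> 2 * 2 ^ k * s ^ k" using s by (intro mult_right_mono) auto
        also have "\<dots> = 2 * (2 * s) ^ k" by (simp add: power_mult_distrib)
        also have "\<dots> \<le> 2 * s0 ^ k" using s by (intro mult_left_mono power_mono) auto
        finally have "real (k + 2) * s ^ k * (s * \<delta>) \<le> 2 * s0 ^ k * (s * \<delta>)"
          using s \<delta> by (intro mult_right_mono) auto
        also have "\<dots> = s0 ^ ?n * (2 / s0\<^sup>2 * s * \<delta>)"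
          using s0 by (simp add: k power_add power2_eq_square)
        finally have "real ?n * s ^ (?n - 1) * \<delta> \<le> s0 ^ ?n * (2 / s0\<^sup>2 * s * \<delta>)"
          by (simp add: k mult_ac)
        then have "\<bar>a b\<bar> * (real ?n * s ^ (?n - 1) * \<delta>) \<le> \<bar>a b\<bar> * (s0 ^ ?n * (2 / s0\<^sup>2 * s * \<delta>))"
          by (rule mult_left_mono) auto
        then show ?thesis using True by (simp add: a'_def mult.assoc)
      next
        case False
        \<comment> \<open>In degree 0 the factor \<open>real ?n\<close> vanishes, in degree 1 the
          coefficient \<open>a' b\<close>.\<close>
        then have "?n = 0 \<or> ?n = 1" by linarith
        then have "\<bar>a' b\<bar> * (real ?n * s ^ (?n - 1) * \<delta>) = 0" by (auto simp: a'_def)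
        moreover have "0 \<le> \<bar>a b\<bar> * s0 ^ ?n * (2 / s0\<^sup>2 * s * \<delta>)" using s \<delta> s0 by simp
        ultimately show ?thesis by linarith
      qed
      with P show "ps_bound \<rho> (\<bar>a b\<bar> * s0 ^ ?n * (2 / s0\<^sup>2 * s * \<delta>))
          (\<lambda>z. a' b * (monomial (w z) b - monomial (w' z) b))" by (rule ps_bound_mono)
    qed
  qed
qed

text \<open>With \<open>y' = 0\<close> and \<open>s = \<delta> = norm y\<close> the estimate becomes
  a quadratic bound on the remainder at the origin.\<close>

lemma linearization_has_derivative:
  fixes u :: "real^'n::finite \<Rightarrow> real"
  assumes s0: "s0 > 0" and C: "C \<ge> 0"
    and lin: "\<And>s \<delta> y y'. \<lbrakk>0 \<le> s; s \<le> s0 / 2; 0 \<le> \<delta>; \<And>i. \<bar>y $ i\<bar> \<le> s; \<And>i. \<bar>y' $ i\<bar> \<le> s;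
      \<And>i. \<bar>y $ i - y' $ i\<bar> \<le> \<delta>\<rbrakk> \<Longrightarrow> \<bar>(u y - q \<bullet> y) - (u y' - q \<bullet> y')\<bar> \<le> C * s * \<delta>"
  shows "(u has_derivative (\<lambda>v. q \<bullet> v)) (at 0)"
  unfolding has_derivative_at_alt
proof (intro conjI allI impI)
  show "bounded_linear (\<lambda>v. q \<bullet> v)" by (rule bounded_linear_inner_right)
  fix \<epsilon> :: real assume \<epsilon>: "\<epsilon> > 0"
  define d where "d = min (s0 / 2) (\<epsilon> / (C + 1))"
  have d: "d > 0" "d \<le> s0 / 2" "d * (C + 1) \<le> \<epsilon>"
  proof -
    show "d > 0" using s0 \<epsilon> C by (simp add: d_def)
    show "d \<le> s0 / 2" unfolding d_def by (rule min.cobounded1)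
    have "d \<le> \<epsilon> / (C + 1)" unfolding d_def by (rule min.cobounded2)
    then show "d * (C + 1) \<le> \<epsilon>" using C by (simp add: pos_le_divide_eq)
  qed
  have "norm (u y - u 0 - q \<bullet> (y - 0)) \<le> \<epsilon> * norm (y - 0)" if y: "norm (y - 0) < d" for y
  proof -
    have "\<bar>(u y - q \<bullet> y) - (u 0 - q \<bullet> 0)\<bar> \<le> C * norm y * norm y"
      by (rule lin) (use y d component_le_norm_cart[of y] in auto)
    also have "\<dots> \<le> \<epsilon> * norm y"
    proof (rule mult_right_mono)
      have "C * norm y \<le> (C + 1) * d" using y d C by (intro mult_mono) auto
      then show "C * norm y \<le> \<epsilon>" using d(3) by (simp add: mult.commute)
    qed auto
    finally show ?thesis by (simp add: algebra_simps)
  qed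
  then show "\<exists>d>0. \<forall>y. norm (y - 0) < d \<longrightarrow> norm (u y - u 0 - q \<bullet> (y - 0)) \<le> \<epsilon> * norm (y - 0)"
    using d(1) by blast
qed

section \<open>Comparison with local analyticity\<close>

text \<open>Unconditional summation of reals is absolute. At the corner with all coordinates
  \<open>s\<close> the monomials equal the weights, so convergence at this one point makes the norm
  finite.\<close>

lemma real_analytic_imp_ps_bound:
  fixes F :: "real^'n::finite \<Rightarrow> real"
  assumes "real_analytic F V" "x \<in> V"
  obtains s M where "s > 0" "ps_bound s M (\<lambda>z. F (x + z))"
proof -
  obtain r c where r: "r > 0" and c: "\<And>y. y \<in> ball x r \<Longrightarrow>
      ((\<lambda>b. c b * (\<Prod>i\<in>UNIV. (y $ i - x $ i) ^ b i)) has_sum F y) UNIV"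
    using assms unfolding real_analytic_def by blast
  \<comment> \<open>The cube of half-width \<open>s\<close> lies in the ball of radius
    \<open>r\<close>, as the Euclidean norm is at most the sum of the absolute coordinates.\<close>
  define s where "s = r / (real CARD('n) + 1)"
  have s: "s > 0" "real CARD('n) * s < r" using r by (auto simp: s_def field_simps)
  have cs: "((\<lambda>b. c b * monomial z b) has_sum F (x + z)) UNIV" if z: "\<And>i. \<bar>z $ i\<bar> \<le> s" for z
  proof -
    have "norm z \<le> (\<Sum>i\<in>UNIV. \<bar>z $ i\<bar>)" by (rule norm_le_l1_cart)
    also have "\<dots> \<le> (\<Sum>i\<in>(UNIV::'n set). s)" by (intro sum_mono z)
    also have "\<dots> < r" using s by simp
    finally have "x + z \<in> ball x r" by (simp add: dist_norm)
    from c[OF this] show ?thesis by (simp add: monomial_def)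
  qed
  have "monomial (\<chi> i. s) b = s ^ total_degree b" for b :: "'n \<Rightarrow> nat"
    by (simp add: monomial_def total_degree_def power_sum)
  then have "((\<lambda>b. c b * s ^ total_degree b) has_sum F (x + (\<chi> i. s))) UNIV"
    using cs[of "\<chi> i. s"] s by simp
  then have "(\<lambda>b. c b * s ^ total_degree b) summable_on UNIV" by (auto simp: summable_on_def)
  then have "(\<lambda>b. \<bar>c b * s ^ total_degree b\<bar>) summable_on UNIV"
    using summable_on_iff_abs_summable_on_real[of "\<lambda>b. c b * s ^ total_degree b"] by simp
  then have "(\<lambda>b. \<bar>c b\<bar> * s ^ total_degree b) summable_on UNIV" using s by (simp add: abs_mult)
  then obtain N where "((\<lambda>b. \<bar>c b\<bar> * s ^ total_degree b) has_sum N) UNIV" by (auto simp: summable_on_def)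
  then have "ps_bound s N (\<lambda>z. F (x + z))" by (rule ps_boundI[OF _ order_refl cs])
  then show ?thesis using s that by blast
qed

text \<open>Recentring at \<open>y\<close> is substitution of the affine map z to (y - x) + z, whose
  components have norm at most \<rho> when the new radius is
  \<open>\<rho> - dist x y\<close>.\<close>

lemma ps_bound_imp_real_analytic:
  fixes u :: "real^'n::finite \<Rightarrow> real"
  assumes u: "ps_bound \<rho> M (\<lambda>z. u (x + z))"
  shows "real_analytic u (ball x \<rho>)"
  unfolding real_analytic_def
proof
  fix y assume y: "y \<in> ball x \<rho>"
  define r where "r = \<rho> - dist x y"
  have r: "r > 0" using y by (simp add: r_def)
  have "ps_bound r M (\<lambda>z. u (x + ((y - x) + z)))"
  proof (rule ps_bound_comp[OF u r])
    fix i
    have "ps_bound r (\<bar>(y - x) $ i\<bar> + r) (\<lambda>z. (y - x) $ i + z $ i)"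
      using r by (intro ps_bound_add ps_bound_const ps_bound_coord) auto
    moreover have "\<bar>(y - x) $ i\<bar> + r \<le> \<rho>"
      using component_le_norm_cart[of "y - x" i] by (simp add: r_def dist_norm norm_minus_commute)
    ultimately show "ps_bound r \<rho> (\<lambda>z. ((y - x) + z) $ i)" using ps_bound_mono by fastforce
  qed
  then have P: "ps_bound r M (\<lambda>z. u (y + z))" by (simp add: add.assoc[symmetric])
  then obtain a where a: "\<And>z. (\<And>i. \<bar>z $ i\<bar> \<le> r) \<Longrightarrow> ((\<lambda>b. a b * monomial z b) has_sum u (y + z)) UNIV"
    by (rule ps_boundE) blast
  have "((\<lambda>b. a b * (\<Prod>i\<in>UNIV. (y' $ i - y $ i) ^ b i)) has_sum u y') UNIV" if "y' \<in> ball y r" for y'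
  proof -
    have "\<bar>(y' - y) $ i\<bar> \<le> r" for i
      using component_le_norm_cart[of "y' - y" i] that by (simp add: dist_norm norm_minus_commute)
    from a[OF this] show ?thesis by (simp add: monomial_def)
  qed
  then show "\<exists>r>0. \<exists>c. \<forall>y'\<in>ball y r. ((\<lambda>b. c b * (\<Prod>i\<in>UNIV. (y' $ i - y $ i) ^ b i)) has_sum u y') UNIV"
    using r by blast
qed

section \<open>The analytic implicit function\<close>

text \<open>Points are constant functions: substituting these turns the norm estimate into one for
  values, which in turn identifies the linear part with the derivative at 0.\<close>

lemma ps_bound_linearization_derivative:
  fixes u :: "real^'n::finite \<Rightarrow> real"
  assumes u: "ps_bound s0 M u" and s0: "s0 > 0"
  obtains q C where "C \<ge> 0" "(u has_derivative (\<lambda>v. q \<bullet> v)) (at 0)"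
    "\<And>\<rho> s \<delta> (w :: real^'n \<Rightarrow> real^'n) w'. \<lbrakk>\<rho> > 0; 0 \<le> s; s \<le> s0 / 2; 0 \<le> \<delta>;
      \<And>i. ps_bound \<rho> s (\<lambda>z. w z $ i); \<And>i. ps_bound \<rho> s (\<lambda>z. w' z $ i);
      \<And>i. ps_bound \<rho> \<delta> (\<lambda>z. w z $ i - w' z $ i)\<rbrakk>
      \<Longrightarrow> ps_bound \<rho> (C * s * \<delta>) (\<lambda>z. (u (w z) - q \<bullet> w z) - (u (w' z) - q \<bullet> w' z))"
    "\<And>s \<delta> y y'. \<lbrakk>0 \<le> s; s \<le> s0 / 2; 0 \<le> \<delta>; \<And>i. \<bar>y $ i\<bar> \<le> s; \<And>i. \<bar>y' $ i\<bar> \<le> s;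
      \<And>i. \<bar>y $ i - y' $ i\<bar> \<le> \<delta>\<rbrakk> \<Longrightarrow> \<bar>(u y - q \<bullet> y) - (u y' - q \<bullet> y')\<bar> \<le> C * s * \<delta>"
proof -
  obtain q C where C: "C \<ge> 0" and lin:
    "\<And>\<rho> s \<delta> (w :: real^'n \<Rightarrow> real^'n) w'. \<lbrakk>\<rho> > 0; 0 \<le> s; s \<le> s0 / 2; 0 \<le> \<delta>;
      \<And>i. ps_bound \<rho> s (\<lambda>z. w z $ i); \<And>i. ps_bound \<rho> s (\<lambda>z. w' z $ i);
      \<And>i. ps_bound \<rho> \<delta> (\<lambda>z. w z $ i - w' z $ i)\<rbrakk>
      \<Longrightarrow> ps_bound \<rho> (C * s * \<delta>) (\<lambda>z. (u (w z) - q \<bullet> w z) - (u (w' z) - q \<bullet> w' z))"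
    by (rule ps_bound_linearization[OF u s0]) blast
  have c: "ps_bound 1 t (\<lambda>_::real^'n. c)" if "\<bar>c\<bar> \<le> t" for c t
    using ps_bound_mono[OF ps_bound_const that, of 1] by simp
  have pt: "\<bar>(u y - q \<bullet> y) - (u y' - q \<bullet> y')\<bar> \<le> C * s * \<delta>"
    if "0 \<le> s" "s \<le> s0 / 2" "0 \<le> \<delta>" "\<And>i. \<bar>y $ i\<bar> \<le> s" "\<And>i. \<bar>y' $ i\<bar> \<le> s"
      "\<And>i. \<bar>y $ i - y' $ i\<bar> \<le> \<delta>" for s \<delta> y y'
  proof -
    have "ps_bound 1 (C * s * \<delta>) (\<lambda>_::real^'n. (u y - q \<bullet> y) - (u y' - q \<bullet> y'))"
      by (rule lin[of 1 s \<delta> "\<lambda>_. y" "\<lambda>_. y'"]) (use that c in auto)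
    from ps_bound_abs_le[OF this, of 0] show ?thesis by simp
  qed
  show ?thesis
  proof (rule that[OF C])
    show "(u has_derivative (\<lambda>v. q \<bullet> v)) (at 0)"
      by (rule linearization_has_derivative[OF s0 C]) (fact pt)
  qed (fact lin, fact pt)
qed

lemma ps_bound_projection:
  fixes e :: "real^'n::finite"
  assumes \<rho>: "\<rho> > 0" and e: "norm e = 1"
  shows "ps_bound \<rho> ((1 + real CARD('n)) * \<rho>) (\<lambda>z. (z - (z \<bullet> e) *\<^sub>R e) $ i)"
proof -
  have e1: "\<bar>e $ j\<bar> \<le> 1" for j using component_le_norm_cart[of e j] e by simp
  have "ps_bound \<rho> (1 * \<rho>) (\<lambda>z. e $ i * (e $ j * z $ j))" for j
  proof (rule ps_bound_mono)
    show "ps_bound \<rho> (\<bar>e $ i\<bar> * (\<bar>e $ j\<bar> * \<rho>)) (\<lambda>z. e $ i * (e $ j * z $ j))"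
      using \<rho> by (intro ps_bound_cmult ps_bound_coord) auto
    have "\<bar>e $ i\<bar> * (\<bar>e $ j\<bar> * \<rho>) \<le> 1 * (1 * \<rho>)"
      using \<rho> e1 by (intro mult_mono) auto
    then show "\<bar>e $ i\<bar> * (\<bar>e $ j\<bar> * \<rho>) \<le> 1 * \<rho>" by simp
  qed
  then have "ps_bound \<rho> (\<rho> + (\<Sum>j\<in>(UNIV::'n set). 1 * \<rho>)) (\<lambda>z. z $ i - (\<Sum>j\<in>UNIV. e $ i * (e $ j * z $ j)))"
    using \<rho> by (intro ps_bound_diff ps_bound_coord ps_bound_sum) auto
  moreover have "z $ i - (\<Sum>j\<in>UNIV. e $ i * (e $ j * z $ j)) = (z - (z \<bullet> e) *\<^sub>R e) $ i" for z :: "real^'n"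
    by (simp add: inner_vec_def sum_distrib_left mult_ac)
  ultimately show ?thesis by (simp add: algebra_simps)
qed

text \<open>The iteration map \<open>T\<close> has \<gamma> as a fixed point. Division by the slope
  \<kappa> of the linear part along \<open>e\<close> cancels that part in the difference of two
  images, so only the increment of the higher-order terms remains, and this is small for small
  arguments.\<close>

lemma ps_bound_implicit_function:
  fixes f \<gamma> :: "real^'n::finite \<Rightarrow> real"
  assumes f: "ps_bound s0 M f" "s0 > 0" and f0: "f 0 = 0" and e: "norm e = 1"
    and df: "(f has_derivative (\<lambda>v. F \<bullet> v)) (at 0)" and Fe: "F \<bullet> e \<noteq> 0"
    and r: "r > 0" and L: "L \<ge> 0"
    and \<gamma>: "\<And>z. z \<in> ball 0 r \<Longrightarrow> f ((z - (z \<bullet> e) *\<^sub>R e) + \<gamma> z *\<^sub>R e) = 0"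
      "\<And>z. z \<in> ball 0 r \<Longrightarrow> \<bar>\<gamma> z\<bar> \<le> L * norm z"
  obtains \<rho> R where "\<rho> > 0" "ps_bound \<rho> R \<gamma>"
proof -
  obtain q C where C: "C \<ge> 0" and dq: "(f has_derivative (\<lambda>v. q \<bullet> v)) (at 0)"
    and lin: "\<And>\<rho> s \<delta> (w :: real^'n \<Rightarrow> real^'n) w'. \<lbrakk>\<rho> > 0; 0 \<le> s; s \<le> s0 / 2; 0 \<le> \<delta>;
      \<And>i. ps_bound \<rho> s (\<lambda>z. w z $ i); \<And>i. ps_bound \<rho> s (\<lambda>z. w' z $ i);
      \<And>i. ps_bound \<rho> \<delta> (\<lambda>z. w z $ i - w' z $ i)\<rbrakk>
      \<Longrightarrow> ps_bound \<rho> (C * s * \<delta>) (\<lambda>z. (f (w z) - q \<bullet> w z) - (f (w' z) - q \<bullet> w' z))"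
    and lin_pt: "\<And>s \<delta> y y'. \<lbrakk>0 \<le> s; s \<le> s0 / 2; 0 \<le> \<delta>; \<And>i. \<bar>y $ i\<bar> \<le> s; \<And>i. \<bar>y' $ i\<bar> \<le> s;
      \<And>i. \<bar>y $ i - y' $ i\<bar> \<le> \<delta>\<rbrakk> \<Longrightarrow> \<bar>(f y - q \<bullet> y) - (f y' - q \<bullet> y')\<bar> \<le> C * s * \<delta>"
    by (rule ps_bound_linearization_derivative[OF f]) blast
  define \<kappa> where "\<kappa> = q \<bullet> e"
  have \<kappa>: "\<kappa> \<noteq> 0" using gradient_unique[OF dq df] Fe by (simp add: \<kappa>_def)
  have e1: "\<bar>e $ j\<bar> \<le> 1" for j using component_le_norm_cart[of e j] e by simp
  define n where "n = real CARD('n)"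
  have n: "n > 0" by (simp add: n_def)
  define Q where "Q = (\<Sum>i\<in>UNIV. \<bar>q $ i\<bar>)"
  have Q: "Q \<ge> 0" unfolding Q_def by (intro sum_nonneg) auto
  \<comment> \<open>The first bound keeps arguments where the linearization is valid; the second
    gives \<open>C * s \<le> \<bar>\<kappa>\<bar> / 2\<close>, hence the contraction factor
    1/2.\<close>
  define s where "s = min (s0 / 2) (\<bar>\<kappa>\<bar> / (2 * (C + 1)))"
  have s: "s > 0" "s \<le> s0 / 2"
  proof -
    show "s > 0" using f(2) \<kappa> C by (simp add: s_def)
    show "s \<le> s0 / 2" unfolding s_def by (rule min.cobounded1)
  qed
  have Cs: "C * s \<le> \<bar>\<kappa>\<bar> / 2"
  proof -
    have "s \<le> \<bar>\<kappa>\<bar> / (2 * (C + 1))" by (simp add: s_def)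
    then have "s * (2 * (C + 1)) \<le> \<bar>\<kappa>\<bar>" using C by (simp add: pos_le_divide_eq)
    then show ?thesis using s(1) by (simp add: algebra_simps)
  qed
  \<comment> \<open>Half of \<open>s\<close> is for the iterates, the other half for the projection
    onto the hyperplane.\<close>
  define R where "R = s / 2"
  have R: "R > 0" "R + R = s" using s by (auto simp: R_def)
  \<comment> \<open>Norm allowed for the projection, solved from the requirement that the first
    increment be at most \<open>R / 2\<close>: its bound is
    \<open>\<tau> / 2 + Q / \<bar>\<kappa>\<bar> * \<tau>\<close>.\<close>
  define \<tau> where "\<tau> = R / (1 + 2 * Q / \<bar>\<kappa>\<bar>)"
  have Qk: "1 + 2 * Q / \<bar>\<kappa>\<bar> \<ge> 1" using Q by simp
  have "1 + 2 * Q / \<bar>\<kappa>\<bar> > 0" using Qk by linarith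
  then have \<tau>: "\<tau> > 0" "\<tau> * (1 + 2 * Q / \<bar>\<kappa>\<bar>) = R" using R(1) by (simp_all add: \<tau>_def)
  have \<tau>R: "\<tau> \<le> R" using \<tau> Qk mult_left_mono[OF Qk, of \<tau>] by simp
  \<comment> \<open>In turn: the projection has norm at most \<tau>, the cube lies in the ball of
    radius \<open>r\<close>, and \<gamma> is at most \<open>R\<close> on the cube.
    \<open>n + 1\<close> in place of \<open>n\<close> makes the second inclusion strict.\<close>
  define \<rho> where "\<rho> = min (\<tau> / (1 + n)) (min (r / (n + 1)) (R / (L * n + 1)))"
  have Ln: "L * n \<ge> 0" using L n by simp
  have \<rho>: "\<rho> > 0" "(1 + n) * \<rho> \<le> \<tau>" "(n + 1) * \<rho> \<le> r" "(L * n + 1) * \<rho> \<le> R"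
  proof -
    show "\<rho> > 0" using \<tau> n r R Ln by (simp add: \<rho>_def)
    have "\<rho> \<le> \<tau> / (1 + n)" "\<rho> \<le> r / (n + 1)" "\<rho> \<le> R / (L * n + 1)" by (auto simp: \<rho>_def)
    then show "(1 + n) * \<rho> \<le> \<tau>" "(n + 1) * \<rho> \<le> r" "(L * n + 1) * \<rho> \<le> R"
      using n Ln by (simp_all add: pos_le_divide_eq mult.commute[of _ \<rho>])
  qed
  define p where "p z = z - (z \<bullet> e) *\<^sub>R e" for z
  have p: "ps_bound \<rho> \<tau> (\<lambda>z. p z $ i)" for i
    using ps_bound_mono[OF ps_bound_projection[OF \<rho>(1) e] \<rho>(2)[unfolded n_def]] by (simp add: p_def)
  define w where "w u z = p z + u z *\<^sub>R e" for u z
  define T where "T u z = u z - f (w u z) / \<kappa>" for u z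
  have w_bound: "ps_bound \<rho> s (\<lambda>z. w u z $ i)" if u: "ps_bound \<rho> R u" for u i
  proof -
    have "ps_bound \<rho> (\<tau> + \<bar>e $ i\<bar> * R) (\<lambda>z. p z $ i + e $ i * u z)"
      by (intro ps_bound_add ps_bound_cmult \<rho>(1) p u)
    moreover have "\<bar>e $ i\<bar> * R \<le> 1 * R" using e1 R by (intro mult_right_mono) auto
    then have "\<tau> + \<bar>e $ i\<bar> * R \<le> s" using \<tau>R R by linarith
    ultimately show ?thesis using ps_bound_mono by (fastforce simp: w_def mult.commute)
  qed
  have qw: "q \<bullet> w u z - q \<bullet> w v z = \<kappa> * (u z - v z)" for u v z
    by (simp add: w_def \<kappa>_def inner_add_right algebra_simps)
  have T_diff: "T u z - T v z = (- 1 / \<kappa>) * ((f (w u z) - q \<bullet> w u z) - (f (w v z) - q \<bullet> w v z))" for u v z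
  proof -
    have *: "(f (w u z) - q \<bullet> w u z) - (f (w v z) - q \<bullet> w v z) = f (w u z) - f (w v z) - \<kappa> * (u z - v z)"
      using qw[of u z v] by simp
    show ?thesis unfolding * T_def using \<kappa> by (simp add: field_simps)
  qed
  have half: "\<bar>- 1 / \<kappa>\<bar> * (C * s * \<delta>) \<le> \<delta> / 2" if "\<delta> \<ge> 0" for \<delta>
  proof -
    have "\<bar>- 1 / \<kappa>\<bar> * (C * s * \<delta>) \<le> \<bar>- 1 / \<kappa>\<bar> * (\<bar>\<kappa>\<bar> / 2 * \<delta>)"
      using Cs that by (intro mult_left_mono mult_right_mono) auto
    also have "\<dots> = \<delta> / 2" using \<kappa> by simp
    finally show ?thesis .
  qed
  have contraction: "ps_bound \<rho> (\<delta> / 2) (\<lambda>z. T u z - T v z)"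
    if u: "ps_bound \<rho> R u" and v: "ps_bound \<rho> R v" and d: "ps_bound \<rho> \<delta> (\<lambda>z. u z - v z)" for u v \<delta>
  proof -
    have \<delta>: "\<delta> \<ge> 0" using ps_bound_nonneg[OF d] \<rho>(1) by simp
    have "ps_bound \<rho> \<delta> (\<lambda>z. w u z $ i - w v z $ i)" for i
    proof -
      have "ps_bound \<rho> (\<bar>e $ i\<bar> * \<delta>) (\<lambda>z. e $ i * (u z - v z))" by (intro ps_bound_cmult \<rho>(1) d)
      moreover have "\<bar>e $ i\<bar> * \<delta> \<le> \<delta>" using mult_right_mono[OF e1[of i] \<delta>] by simp
      moreover have "(\<lambda>z. e $ i * (u z - v z)) = (\<lambda>z. w u z $ i - w v z $ i)"
        by (simp add: w_def fun_eq_iff algebra_simps)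
      ultimately show ?thesis using ps_bound_mono by metis
    qed
    from ps_bound_cmult[OF \<rho>(1) lin[OF \<rho>(1) less_imp_le[OF s(1)] s(2) \<delta> w_bound[OF u] w_bound[OF v] this], of "- 1 / \<kappa>"]
    have "ps_bound \<rho> (\<bar>- 1 / \<kappa>\<bar> * (C * s * \<delta>)) (\<lambda>z. T u z - T v z)" by (simp only: T_diff)
    then show ?thesis using half[OF \<delta>] by (rule ps_bound_mono)
  qed
  \<comment> \<open>With no power series for \<gamma> yet, only values at \<open>z\<close> are
    compared; as a fixed point of \<open>T\<close>, \<gamma> attracts the iterates.\<close>
  have contraction_pt: "\<bar>T u z - \<gamma> z\<bar> \<le> \<bar>u z - \<gamma> z\<bar> / 2"
    if u: "ps_bound \<rho> R u" and z: "\<And>i. \<bar>z $ i\<bar> \<le> \<rho>" for u z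
  proof -
    have "norm z \<le> (\<Sum>i\<in>UNIV. \<bar>z $ i\<bar>)" by (rule norm_le_l1_cart)
    also have "\<dots> \<le> (\<Sum>i\<in>(UNIV::'n set). \<rho>)" by (intro sum_mono z)
    finally have nz: "norm z \<le> n * \<rho>" by (simp add: n_def)
    then have zr: "z \<in> ball 0 r" using \<rho> by (simp add: algebra_simps)
    have "\<bar>\<gamma> z\<bar> \<le> L * (n * \<rho>)" using \<gamma>(2)[OF zr] mult_left_mono[OF nz L] by linarith
    then have \<gamma>R: "\<bar>\<gamma> z\<bar> \<le> R" using \<rho>(1,4) by (simp add: algebra_simps)
    have wb: "\<bar>w u z $ i\<bar> \<le> s" for i by (rule ps_bound_abs_le[OF w_bound[OF u] z])
    have w\<gamma>: "\<bar>w \<gamma> z $ i\<bar> \<le> s" for i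
    proof -
      have "\<bar>p z $ i\<bar> \<le> R" using ps_bound_abs_le[OF p z] \<tau>R order_trans by blast
      moreover have "\<bar>\<gamma> z * e $ i\<bar> \<le> R"
        using mult_mono[OF \<gamma>R e1[of i]] R by (simp add: abs_mult)
      ultimately show ?thesis using R(2) by (simp add: w_def)
    qed
    have "\<bar>w u z $ i - w \<gamma> z $ i\<bar> \<le> \<bar>u z - \<gamma> z\<bar>" for i
    proof -
      have "w u z $ i - w \<gamma> z $ i = (u z - \<gamma> z) * e $ i" by (simp add: w_def algebra_simps)
      then show ?thesis using mult_left_mono[OF e1[of i], of "\<bar>u z - \<gamma> z\<bar>"] by (simp add: abs_mult)
    qed
    from lin_pt[OF less_imp_le[OF s(1)] s(2) _ wb w\<gamma> this]
    have "\<bar>- 1 / \<kappa>\<bar> * \<bar>(f (w u z) - q \<bullet> w u z) - (f (w \<gamma> z) - q \<bullet> w \<gamma> z)\<bar> \<le> \<bar>- 1 / \<kappa>\<bar> * (C * s * \<bar>u z - \<gamma> z\<bar>)"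
      by (intro mult_left_mono) auto
    then have "\<bar>T u z - T \<gamma> z\<bar> \<le> \<bar>u z - \<gamma> z\<bar> / 2"
      unfolding T_diff abs_mult by (rule order_trans[OF _ half[OF abs_ge_zero]])
    moreover have "T \<gamma> z = \<gamma> z" using \<gamma>(1)[OF zr] by (simp add: T_def w_def p_def)
    ultimately show ?thesis by simp
  qed
  define U where "U k = (T ^^ k) (\<lambda>_. 0)" for k
  have U_Suc: "U (Suc k) = T (U k)" for k by (simp add: U_def)
  have zero: "ps_bound \<rho> 0 (\<lambda>_. 0)" using ps_bound_const[of \<rho> 0] \<rho>(1) by simp
  \<comment> \<open>The first iterate is - f(p z) / \<kappa>. It is split into the remainder
    relative to the zero map, of norm at most \<open>C * \<tau> * \<tau>\<close>, and the linear
    part, of norm at most \<open>Q * \<tau>\<close>.\<close>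
  have first: "ps_bound \<rho> (R / 2) (\<lambda>z. U 1 z - U 0 z)"
  proof -
    have "ps_bound \<rho> (C * \<tau> * \<tau>) (\<lambda>z. (f (p z) - q \<bullet> p z) - (f ((\<lambda>_. 0) z) - q \<bullet> (\<lambda>_. 0) z))"
      by (rule lin) (use \<rho>(1) \<tau> \<tau>R R s p zero ps_bound_mono[OF zero less_imp_le[OF \<tau>(1)]] in auto)
    moreover have "ps_bound \<rho> (\<Sum>i\<in>UNIV. \<bar>q $ i\<bar> * \<tau>) (\<lambda>z. \<Sum>i\<in>UNIV. q $ i * p z $ i)"
      by (intro ps_bound_sum ps_bound_cmult p \<rho>(1))
    ultimately have "ps_bound \<rho> (C * \<tau> * \<tau> + (\<Sum>i\<in>UNIV. \<bar>q $ i\<bar> * \<tau>))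
        (\<lambda>z. ((f (p z) - q \<bullet> p z) - (f ((\<lambda>_. 0) z) - q \<bullet> (\<lambda>_. 0) z)) + (\<Sum>i\<in>UNIV. q $ i * p z $ i))"
      by (rule ps_bound_add[OF \<rho>(1)])
    then have "ps_bound \<rho> (C * \<tau> * \<tau> + Q * \<tau>) (\<lambda>z. f (p z))"
      by (simp add: f0 inner_vec_def Q_def sum_distrib_right)
    from ps_bound_cmult[OF \<rho>(1) this, of "- 1 / \<kappa>"]
    have "ps_bound \<rho> (\<bar>- 1 / \<kappa>\<bar> * (C * \<tau> * \<tau> + Q * \<tau>)) (\<lambda>z. U 1 z - U 0 z)"
      by (simp add: U_def T_def w_def)
    moreover have "\<bar>- 1 / \<kappa>\<bar> * (C * \<tau> * \<tau> + Q * \<tau>) \<le> R / 2"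
    proof -
      have "C * \<tau> * \<tau> \<le> C * s * \<tau>" using \<tau> \<tau>R R C by (intro mult_right_mono mult_left_mono) auto
      then have "\<bar>- 1 / \<kappa>\<bar> * (C * \<tau> * \<tau> + Q * \<tau>) \<le> \<bar>- 1 / \<kappa>\<bar> * (C * s * \<tau> + Q * \<tau>)"
        by (intro mult_left_mono) auto
      also have "\<dots> \<le> \<tau> / 2 + Q / \<bar>\<kappa>\<bar> * \<tau>" using half[of \<tau>] \<tau> by (simp add: algebra_simps)
      also have "\<dots> = \<tau> * (1 + 2 * Q / \<bar>\<kappa>\<bar>) / 2" by (simp add: algebra_simps)
      finally show ?thesis using \<tau>(2) by simp
    qed
    ultimately show ?thesis by (rule ps_bound_mono)
  qed
  \<comment> \<open>\<open>R - R * (1/2) ^ k\<close> is the sum of the first \<open>k\<close>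
    increment bounds; it stays below \<open>R\<close>, where the contraction estimate
    applies.\<close>
  have U: "ps_bound \<rho> (R - R * (1/2) ^ k) (U k) \<and> ps_bound \<rho> (R * (1/2) ^ Suc k) (\<lambda>z. U (Suc k) z - U k z)" for k
  proof (induction k)
    case 0
    then show ?case using first zero by (simp add: U_def)
  next
    case (Suc k)
    have "ps_bound \<rho> (R - R * (1/2) ^ k + R * (1/2) ^ Suc k) (\<lambda>z. U k z + (U (Suc k) z - U k z))"
      by (intro ps_bound_add \<rho>(1)) (use Suc in auto)
    then have 1: "ps_bound \<rho> (R - R * (1/2) ^ Suc k) (U (Suc k))" by (simp add: field_simps)
    have "R - R * (1/2) ^ j \<le> R" for j using R by simp
    then have "ps_bound \<rho> R (U (Suc k))" "ps_bound \<rho> R (U k)"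
      using 1 Suc ps_bound_mono by blast+
    from contraction[OF this conjunct2[OF Suc]] 1
    show ?case by (simp add: U_Suc mult.commute)
  qed
  have UR: "ps_bound \<rho> R (U k)" for k
    by (rule ps_bound_mono[OF conjunct1[OF U[of k]]]) (use R in auto)
  \<comment> \<open>The increment bounds add up to \<open>R\<close>, so the sum of the increments
    has a power series; pointwise convergence of the iterates shows that this sum is
    \<gamma>.\<close>
  have "ps_bound \<rho> R \<gamma>"
  proof (rule ps_bound_has_sum[OF \<rho>(1) conjunct2[OF U]])
    have "(\<lambda>k. R * (1/2) ^ Suc k) sums (R * 1)"
      using sums_mult[OF power_half_series] .
    then have hs: "(\<lambda>k. R * (1/2) ^ Suc k) sums R" by simp
    then show "((\<lambda>k. R * (1/2) ^ Suc k) has_sum R) UNIV"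
      by (rule sums_nonneg_imp_has_sum) (use R in auto)
    fix z :: "real^'n" assume z: "\<And>i. \<bar>z $ i\<bar> \<le> \<rho>"
    show "((\<lambda>k. U (Suc k) z - U k z) has_sum \<gamma> z) UNIV"
    proof (rule norm_summable_imp_has_sum)
      have b: "norm (U (Suc k) z - U k z) \<le> R * (1/2) ^ Suc k" for k
        using ps_bound_abs_le[OF conjunct2[OF U] z] by simp
      show "summable (\<lambda>k. norm (U (Suc k) z - U k z))"
        by (rule summable_comparison_test'[OF sums_summable[OF hs], of 0]) (use b in auto)
      have "\<bar>U k z - \<gamma> z\<bar> \<le> \<bar>\<gamma> z\<bar> * (1/2) ^ k" for k
      proof (induction k)
        case (Suc k)
        then show ?case using contraction_pt[OF UR[of k] z] by (simp add: U_Suc)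
      qed (simp add: U_def)
      moreover have "(\<lambda>k. \<bar>\<gamma> z\<bar> * (1/2) ^ k) \<longlonglongrightarrow> 0"
        using tendsto_mult_right_zero[OF LIMSEQ_power_zero[of "1/2::real"]] by simp
      ultimately have "(\<lambda>k. U k z - \<gamma> z) \<longlonglongrightarrow> 0"
        by (intro Lim_null_comparison[of "\<lambda>k. U k z - \<gamma> z"]) auto
      then have "(\<lambda>k. U k z) \<longlonglongrightarrow> \<gamma> z" by (simp add: LIM_zero_iff)
      from telescope_sums[OF this] show "(\<lambda>k. U (Suc k) z - U k z) sums \<gamma> z" by (simp add: U_def)
    qed
  qed
  then show ?thesis using that \<rho>(1) by blast
qed

text \<open>The implicit equation comes from an analytic extension \<open>G\<close> of a component
  whose difference with the coordinate has nonzero derivative at \<open>x\<close>. This difference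
  vanishes at \<open>lift (x + z)\<close>, so \<gamma> solves the equation.\<close>

lemma (in local_graph) \<gamma>_ps_bound_near:
  assumes x: "x \<in> frontier W"
    and \<Psi>: "\<And>i. real_analytic_closure (\<lambda>x. \<Psi> x $ i) W"
    and inj: "inj_on \<Psi> (closure W)" and id: "\<And>x. x \<in> frontier W \<Longrightarrow> \<Psi> x = x"
    and ne: "push_forward_coeff W \<Psi> x \<noteq> mat 1"
  obtains \<rho> R where "\<rho> > 0" "ps_bound \<rho> R (\<lambda>z. \<gamma> (x + z))"
proof -
  have xc: "x \<in> closure W" using x by (simp add: frontier_def)
  have near: "x + z \<in> ball x (r / (L + 2))" if "z \<in> ball 0 (r / (L + 2))" for z
    using that by (simp add: dist_norm)
  obtain i where i: "\<not> ((\<lambda>y. \<Psi> y $ i - y $ i) has_derivative (\<lambda>v. 0)) (at x within closure W)"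
    using push_forward_coeff_eq_mat_1[OF _ inj xc id[OF x]] ne by blast
  obtain V G where G: "closure W \<subseteq> V" "real_analytic G V" "\<And>y. y \<in> closure W \<Longrightarrow> G y = \<Psi> y $ i"
    using \<Psi>[of i] unfolding real_analytic_closure_def by blast
  have "x \<in> V" using xc G(1) by auto
  from real_analytic_imp_ps_bound[OF G(2) this] obtain s M where s: "s > 0" "ps_bound s M (\<lambda>z. G (x + z))"
    by blast
  have P: "ps_bound s (M + (\<bar>x $ i\<bar> + s)) (\<lambda>z. G (x + z) - (x + z) $ i)"
    unfolding vector_add_component
    using s by (intro ps_bound_diff ps_bound_add ps_bound_const ps_bound_coord) auto
  obtain q where q: "((\<lambda>z. G (x + z) - (x + z) $ i) has_derivative (\<lambda>v. q \<bullet> v)) (at 0)"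
    by (rule ps_bound_linearization_derivative[OF P s(1)])
  \<comment> \<open>\<open>G\<close> agrees with the component on the closure, so its full gradient
    at \<open>x\<close> is also a derivative relative to the closure, and transversality to
    \<open>e\<close> follows.\<close>
  have d: "((\<lambda>y. \<Psi> y $ i - y $ i) has_derivative (\<lambda>v. q \<bullet> v)) (at x within closure W)"
  proof (rule has_derivative_transform[OF xc])
    have shift: "((\<lambda>y. y - x) has_derivative (\<lambda>v. v)) (at x)" by (auto intro!: derivative_eq_intros)
    have "((\<lambda>y. G (x + (y - x)) - (x + (y - x)) $ i) has_derivative (\<lambda>v. q \<bullet> v)) (at x)"
      by (rule has_derivative_compose[OF shift]) (use q in simp)
    then show "((\<lambda>y. G y - y $ i) has_derivative (\<lambda>v. q \<bullet> v)) (at x within closure W)"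
      by (simp add: has_derivative_at_withinI)
  qed (simp add: G)
  have "q \<noteq> 0" using d i by auto
  then have qe: "q \<bullet> e \<noteq> 0"
    by (rule gradient_e_nonzero[OF d, rotated]) (use id in auto)
  show ?thesis
  proof (rule ps_bound_implicit_function[OF P s(1) _ norm_e q qe _ L_nonneg])
    show "G (x + 0) - (x + 0) $ i = 0" using G(3)[OF xc] id[OF x] by simp
    show "0 < r / (L + 2)" using r_pos L_nonneg by simp
    show "G (x + ((z - (z \<bullet> e) *\<^sub>R e) + \<gamma> (x + z) *\<^sub>R e)) - (x + ((z - (z \<bullet> e) *\<^sub>R e) + \<gamma> (x + z) *\<^sub>R e)) $ i = 0"
      if z: "z \<in> ball 0 (r / (L + 2))" for z
    proof -
      have *: "x + ((z - (z \<bullet> e) *\<^sub>R e) + \<gamma> (x + z) *\<^sub>R e) = lift (x + z)"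
        by (simp add: lift_def algebra_simps)
      show ?thesis unfolding * using lift_in_frontier[OF near[OF z]] G(3) id by simp
    qed
    show "\<bar>\<gamma> (x + z)\<bar> \<le> L * norm z" if z: "z \<in> ball 0 (r / (L + 2))" for z
    proof -
      have "x + z \<in> ball x r" using near[OF z] small_ball_subset by blast
      from \<gamma>_lipschitz[OF this, of x] show ?thesis using r_pos by (simp add: \<gamma>_base dist_norm)
    qed
  qed (rule that)
qed

section \<open>Regularity of the boundary\<close>

theorem mainTheorem6:
  fixes \<Omega> :: "(real^'n::finite) set"
    and \<Psi> :: "real^'n \<Rightarrow> real^'n"
    and \<nu> :: "real^'n \<Rightarrow> real^'n"
    and A :: "real^'n \<Rightarrow> real^'n^'n"
    and \<alpha> :: real
    and m :: nat
  assumes "CARD('n) \<ge> 2"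
    and "0 < \<alpha>" and "\<alpha> < 1"
    and "m \<ge> 1"
    and "bounded \<Omega>"
    and "regular_domain (C_k_holder 1 \<alpha>) \<Omega>"
    and "connected (- closure \<Omega>)"
    and "\<forall>x\<in>frontier \<Omega>. \<Psi> x = x"
    and "\<forall>x\<in>frontier \<Omega>. is_unit_outward_normal \<Omega> x (\<nu> x)"
    and "\<forall>x\<in>closure \<Omega>. A x = push_forward_coeff \<Omega> \<Psi> x"
  shows "(diffeo_on_closure (C_k_closure (m + 2)) \<Psi> \<Omega> \<longrightarrow>
            (\<forall>x\<^sub>0\<in>frontier \<Omega>. boundary_irregular_near (C_k_holder m \<alpha>) \<Omega> x\<^sub>0 \<longrightarrow>
               A x\<^sub>0 *v \<nu> x\<^sub>0 = \<nu> x\<^sub>0)) \<and>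
         (diffeo_on_closure C_infty_closure \<Psi> \<Omega> \<longrightarrow>
            (\<forall>x\<^sub>0\<in>frontier \<Omega>. boundary_irregular_near C_infty \<Omega> x\<^sub>0 \<longrightarrow>
               A x\<^sub>0 *v \<nu> x\<^sub>0 = \<nu> x\<^sub>0)) \<and>
         (diffeo_on_closure real_analytic_closure \<Psi> \<Omega> \<longrightarrow>
            (\<forall>x\<^sub>0\<in>frontier \<Omega>. boundary_irregular_near real_analytic \<Omega> x\<^sub>0 \<longrightarrow>
               A x\<^sub>0 *v \<nu> x\<^sub>0 = \<nu> x\<^sub>0))"
proof -
  have open_\<Omega>: "open \<Omega>" and reg: "\<And>x. x \<in> frontier \<Omega> \<Longrightarrow> boundary_regular_at (C_k_holder 1 \<alpha>) \<Omega> x"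
    using assms(6) by (auto simp: regular_domain_def boundary_regular_in_def)
  \<comment> \<open>Common to the three classes: \<open>regular\<close> turns a nontrivial
    coefficient into regularity of the graph near \<open>x\<close>, contradicting the
    irregularity.\<close>
  have main: "A x *v \<nu> x = \<nu> x"
    if diffeo: "diffeo_on_closure RC \<Psi> \<Omega>" and x: "x \<in> frontier \<Omega>" and irr: "boundary_irregular_near R \<Omega> x"
      and regular: "\<And>e r \<gamma> L. \<lbrakk>local_graph \<Omega> x e r \<gamma> L; push_forward_coeff \<Omega> \<Psi> x \<noteq> mat 1\<rbrakk> \<Longrightarrow>
        \<exists>\<rho>>0. \<rho> \<le> r \<and> (\<forall>y c. y \<in> ball x \<rho> \<longrightarrow>
          (\<exists>r'>0. ball y r' \<subseteq> ball x \<rho> \<and> R (\<lambda>z. \<gamma> z - c) (ball y r')))"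
    for R RC x
  proof (rule ccontr)
    assume "A x *v \<nu> x \<noteq> \<nu> x"
    moreover have "A x = push_forward_coeff \<Omega> \<Psi> x" using assms(10) x by (auto simp: frontier_def)
    ultimately have ne: "push_forward_coeff \<Omega> \<Psi> x \<noteq> mat 1" by auto
    obtain e r \<gamma> L where "local_graph \<Omega> x e r \<gamma> L"
      using boundary_regular_imp_local_graph[OF open_\<Omega> reg[OF x] x] .
    then interpret local_graph \<Omega> x e r \<gamma> L .
    obtain \<rho> where \<rho>: "\<rho> > 0" "\<rho> \<le> r" "\<And>y c. y \<in> ball x \<rho> \<Longrightarrow>
        \<exists>r'>0. ball y r' \<subseteq> ball x \<rho> \<and> R (\<lambda>z. \<gamma> z - c) (ball y r')"
      using regular[OF local_graph_axioms ne] by blast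
    have "boundary_regular_in R \<Omega> (ball x \<rho>)" by (rule boundary_regular_in_ball[where R = R, OF \<rho>(1,2) \<rho>(3)])
    then show False using irr \<rho>(1) by (auto simp: boundary_irregular_near_def)
  qed
  have inj: "inj_on \<Psi> (closure \<Omega>)" if "diffeo_on_closure RC \<Psi> \<Omega>" for RC
    using that by (simp add: diffeo_on_closure_def bij_betw_def)
  have id: "\<And>x. x \<in> frontier \<Omega> \<Longrightarrow> \<Psi> x = x" using assms(8) by blast
  have small: "\<exists>r'>0. ball y r' \<subseteq> ball x \<rho>" if "y \<in> ball x \<rho>" for x y :: "real^'n" and \<rho>
    using that open_contains_ball[of "ball x \<rho>"] by auto
  show ?thesis
  proof (intro conjI impI ballI)
    fix x assume d: "diffeo_on_closure (C_k_closure (m + 2)) \<Psi> \<Omega>" and x: "x \<in> frontier \<Omega>"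
      and irr: "boundary_irregular_near (C_k_holder m \<alpha>) \<Omega> x"
    have \<Psi>: "Ck_ext k (\<lambda>x. \<Psi> x $ i) \<Omega> (closure \<Omega>)" if "k \<le> m + 2" for i k
    proof -
      have "C_k_closure (m + 2) (\<lambda>x. \<Psi> x $ i) \<Omega>" using d by (simp only: diffeo_on_closure_def)
      from Ck_ext_mono[OF that C_k_closure_imp_Ck_ext[OF open_\<Omega> this]] show ?thesis .
    qed
    show "A x *v \<nu> x = \<nu> x"
    proof (rule main[OF d x irr])
      fix e r \<gamma> L assume g: "local_graph \<Omega> x e r \<gamma> L" and ne: "push_forward_coeff \<Omega> \<Psi> x \<noteq> mat 1"
      obtain \<rho> where \<rho>: "\<rho> > 0" "\<rho> \<le> r"
        and smooth: "\<And>k. (\<And>i. Ck_ext k (\<lambda>x. \<Psi> x $ i) \<Omega> (closure \<Omega>)) \<Longrightarrow> Ck_ext k \<gamma> (ball x \<rho>) (ball x \<rho>)"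
        using graph_Ck_ext_if_nontrivial_coeff[OF open_\<Omega> g x \<Psi> inj[OF d] id ne] by auto
      \<comment> \<open>One order above \<open>m\<close> is spent on the Hoelder bound for the
        derivatives of order \<open>m\<close>.\<close>
      have "Ck_ext (Suc m) (\<lambda>z. \<gamma> z - c) (ball x \<rho>) (ball x \<rho>)" for c
        by (intro Ck_ext_diff Ck_ext_const smooth \<Psi>) auto
      from Ck_ext_imp_C_k_holder[OF this open_ball]
      have "\<exists>r'>0. ball y r' \<subseteq> ball x \<rho> \<and> C_k_holder m \<alpha> (\<lambda>z. \<gamma> z - c) (ball y r')" if "y \<in> ball x \<rho>" for y c
        using that assms(3) by (metis less_imp_le)
      then show "\<exists>\<rho>>0. \<rho> \<le> r \<and> (\<forall>y c. y \<in> ball x \<rho> \<longrightarrow>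
          (\<exists>r'>0. ball y r' \<subseteq> ball x \<rho> \<and> C_k_holder m \<alpha> (\<lambda>z. \<gamma> z - c) (ball y r')))"
        using \<rho> by blast
    qed
  next
    fix x assume d: "diffeo_on_closure C_infty_closure \<Psi> \<Omega>" and x: "x \<in> frontier \<Omega>"
      and irr: "boundary_irregular_near C_infty \<Omega> x"
    have \<Psi>: "Ck_ext k (\<lambda>x. \<Psi> x $ i) \<Omega> (closure \<Omega>)" for i k
      using d C_k_closure_imp_Ck_ext[OF open_\<Omega>] by (auto simp: diffeo_on_closure_def C_infty_closure_def)
    show "A x *v \<nu> x = \<nu> x"
    proof (rule main[OF d x irr])
      fix e r \<gamma> L assume g: "local_graph \<Omega> x e r \<gamma> L" and ne: "push_forward_coeff \<Omega> \<Psi> x \<noteq> mat 1"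
      obtain \<rho> where \<rho>: "\<rho> > 0" "\<rho> \<le> r"
        and smooth: "\<And>k. (\<And>i. Ck_ext k (\<lambda>x. \<Psi> x $ i) \<Omega> (closure \<Omega>)) \<Longrightarrow> Ck_ext k \<gamma> (ball x \<rho>) (ball x \<rho>)"
        using graph_Ck_ext_if_nontrivial_coeff[OF open_\<Omega> g x \<Psi> inj[OF d] id ne] by auto
      have "Ck_ext k (\<lambda>z. \<gamma> z - c) (ball x \<rho>) (ball x \<rho>)" for k c
        by (intro Ck_ext_diff Ck_ext_const smooth \<Psi>)
      \<comment> \<open>\<rho> was fixed before \<open>k\<close>, so one ball carries all
        orders.\<close>
      then have "C_infty (\<lambda>z. \<gamma> z - c) (ball y r')" if "ball y r' \<subseteq> ball x \<rho>" for y r' c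
        unfolding C_infty_def using Ck_ext_imp_C_k[OF open_ball] Ck_ext_subset that by blast
      then show "\<exists>\<rho>>0. \<rho> \<le> r \<and> (\<forall>y c. y \<in> ball x \<rho> \<longrightarrow>
          (\<exists>r'>0. ball y r' \<subseteq> ball x \<rho> \<and> C_infty (\<lambda>z. \<gamma> z - c) (ball y r')))"
        using \<rho> small by meson
    qed
  next
    fix x assume d: "diffeo_on_closure real_analytic_closure \<Psi> \<Omega>" and x: "x \<in> frontier \<Omega>"
      and irr: "boundary_irregular_near real_analytic \<Omega> x"
    have \<Psi>: "real_analytic_closure (\<lambda>x. \<Psi> x $ i) \<Omega>" for i
      using d by (simp add: diffeo_on_closure_def)
    show "A x *v \<nu> x = \<nu> x"
    proof (rule main[OF d x irr])
      fix e r \<gamma> L assume g: "local_graph \<Omega> x e r \<gamma> L" and ne: "push_forward_coeff \<Omega> \<Psi> x \<noteq> mat 1"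
      obtain \<rho> R where \<rho>: "\<rho> > 0" and R: "ps_bound \<rho> R (\<lambda>z. \<gamma> (x + z))"
        using local_graph.\<gamma>_ps_bound_near[OF g x \<Psi> inj[OF d] id ne] by blast
      have analytic: "real_analytic (\<lambda>z. \<gamma> z - c) (ball x \<rho>)" for c
        by (rule ps_bound_imp_real_analytic[OF ps_bound_diff[OF \<rho> R ps_bound_const[of \<rho> c]]]) (use \<rho> in auto)
      \<comment> \<open>\<rho> comes from the power series and is unrelated to \<open>r\<close>,
        while \<Omega> is described by the graph only in the ball of radius \<open>r\<close>; hence
        the minimum.\<close>
      have "real_analytic (\<lambda>z. \<gamma> z - c) (ball y r')" if "ball y r' \<subseteq> ball x (min \<rho> r)" for y r' c
      proof -
        have "ball y r' \<subseteq> ball x \<rho>" using that by auto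
        then show ?thesis using analytic[of c] unfolding real_analytic_def by blast
      qed
      moreover have "min \<rho> r > 0" using \<rho> local_graph.r_pos[OF g] by simp
      moreover have "min \<rho> r \<le> r" by simp
      ultimately show "\<exists>\<rho>>0. \<rho> \<le> r \<and> (\<forall>y c. y \<in> ball x \<rho> \<longrightarrow>
          (\<exists>r'>0. ball y r' \<subseteq> ball x \<rho> \<and> real_analytic (\<lambda>z. \<gamma> z - c) (ball y r')))"
        using small by meson
    qed
  qed
qed

end
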